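(* Let $0\le p\le 2$ and let $f(z)=z+a_2z^2+a_3z^3+\cdots\in\mathcal{K}(p)$. Then $$|a_3-a_2|\le\frac{(2p+1)(2-p)}{6},$$ and $$|a_4-a_3|\le\begin{cases}\dfrac{p^3+50p^2-64p+64}{192}, & 0\le p<\dfrac87,\\[2mm] \dfrac{-3p^3+4p^2+6p-4}{12}, & \dfrac87\le p\le 2.\end{cases}$$ Both inequalities are sharp: for each $p\in[0,2]$ there is a function in $\mathcal{K}(p)$ attaining equality. Furthermore, $$\sup_{f\in\mathcal{K}^+}|a_3(f)-a_2(f)|=\frac{25}{48},$$ attained by $L_\phi$ with $\phi=\arccos(3/8)$, and $$\sup_{f\in\mathcal{K}^+}|a_4(f)-a_3(f)|=\frac{35\sqrt{70}-49}{729},$$ attained by $L_\phi$ with $\phi=\arccos\big((4+\sqrt{70})/18\big)$.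
   Context: $\mathbb{D}$ is the open unit disk. $\mathcal{K}$ is the class of analytic univalent functions $f(z)=z+\sum_{n\ge2}a_n(f)z^n$ on $\mathbb{D}$ with $f(\mathbb{D})$ convex. For $0\le p\le2$, $\mathcal{K}(p)=\{f\in\mathcal{K}: f''(0)=p\}$, and $\mathcal{K}^+=\bigcup_{0\le p\le 2}\mathcal{K}(p)$. For $\phi\in\mathbb{R}$, $L_\phi(z)=\frac{1}{e^{i\phi}-e^{-i\phi}}\log\frac{1-e^{-i\phi}z}{1-e^{i\phi}z}=\sum_{n\ge1}\frac{\sin n\phi}{n\sin\phi}z^n$ (interpreted by continuity when $\sin\phi=0$). *)

theory Defs
  imports "HOL-Analysis.Analysis"
begin

definition taylor_coeff :: "(complex \<Rightarrow> complex) \<Rightarrow> nat \<Rightarrow> complex" where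
  "taylor_coeff f n = (deriv ^^ n) f 0 / of_nat (fact n)"

definition convK :: "(complex \<Rightarrow> complex) set" where
  "convK = {f. f holomorphic_on ball 0 1 \<and> inj_on f (ball 0 1) \<and> f 0 = 0 \<and> deriv f 0 = 1
              \<and> convex (f ` ball 0 1)}"

definition convKp :: "real \<Rightarrow> (complex \<Rightarrow> complex) set" where
  "convKp p = {f \<in> convK. (deriv ^^ 2) f 0 = complex_of_real p}"

definition convKplus :: "(complex \<Rightarrow> complex) set" where
  "convKplus = (\<Union>p\<in>{0..2}. convKp p)"

text \<open>Coefficients of L_phi: sin(n phi)/(n sin phi), extended by continuity when sin phi = 0
  (then cos phi = +-1 and the limit is (cos phi)^(n-1)).\<close>
definition L_coeff :: "real \<Rightarrow> nat \<Rightarrow> real" where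
  "L_coeff \<phi> n = (if sin \<phi> = 0 then cos \<phi> ^ (n - 1) else sin (real n * \<phi>) / (real n * sin \<phi>))"

definition L_fun :: "real \<Rightarrow> complex \<Rightarrow> complex" where
  "L_fun \<phi> z = (\<Sum>n. complex_of_real (L_coeff \<phi> (Suc n)) * z ^ Suc n)"

end

theory Submission
  imports Defs "HOL-Complex_Analysis.Complex_Analysis"
begin

text \<open>
  A normalised locally univalent \<open>f\<close> is convex iff \<open>Re (1 + z f''/f') \<ge> 0\<close>, i.e. iff
  \<open>\<psi> = f'' / (2 f' + z f'')\<close> is bounded by 1 on the disk. The first Schur parameters
  \<open>s = p/2\<close>, \<open>x\<close>, \<open>\<kappa>\<close> of \<open>\<psi>\<close> range over the closed unit disk, and with \<open>t = 1 - s\<^sup>2\<close>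
  the coefficient differences become
  \<open>3 (a\<^sub>3 - a\<^sub>2) = -3 s (1 - s) + t x\<close> and
  \<open>6 (a\<^sub>4 - a\<^sub>3) = -6 s\<^sup>2 (1 - s) + t ((5 s - 2) x - s x\<^sup>2 + (1 - |x|\<^sup>2) \<kappa>)\<close>.
  The triangle inequality is an equality here for real \<open>x\<close> of the right sign and \<open>\<kappa> = -1\<close>, so
  everything reduces to maximising a quadratic in \<open>|x|\<close>; \<open>x = -1\<close> gives \<open>L_fun\<close>.
\<close>

section \<open>Schur parameters\<close>

text \<open>The class is defined by the shape of the image, so the curvature condition has to be
  linked to it in both directions. Convexity yields only the weak inequality Re (1 + z f''/f') >= 0,
  whereas the supporting line argument for the converse uses a strictly turning tangent. The bound
  on \<open>\<psi>\<close> closes this gap: w = z f''/f' satisfies w = z \<open>\<psi>\<close> (2 +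
  w), and the factor |z| < 1 gives |w| < |2 + w|, that is Re (1 + w) > 0. For f''(0) = p the first
  parameter s = p/2 is real while x and \<open>\<kappa>\<close> stay complex; after the triangle
  inequality only r = |x| survives. The 5 s - 2 combines 5 s from 6 a4 with -2 from 2 * (3 a3). The
  quadratic in r has its vertex at |5 s - 2| / (2 (1 - s)), which exceeds 1 exactly for s > 4/7,
  that is p > 8/7; hence the two branches. For L_phi one has s = cos phi, so 3/8 and (4 + sqrt
  70)/18 are half the maximising values of p.\<close>

lemma schwarz_factor_bound:
  fixes h :: "complex \<Rightarrow> complex"
  assumes holo: "h holomorphic_on ball 0 1"
    and bound: "\<And>z. cmod z < 1 \<Longrightarrow> cmod (z * h z) \<le> 1"
    and z: "cmod z < 1"
  shows "cmod (h z) \<le> 1"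
proof -
  \<comment> \<open>The Schwarz lemma wants values strictly inside the disk, but only a weak bound
    is given. A factor c < 1 makes it strict; c is pushed to 1 at the end.\<close>
  have scaled: "c * cmod (h z) \<le> 1" if c: "0 < c" "c < 1" for c
  proof -
    let ?f = "\<lambda>w. of_real c * (w * h w)"
    have f: "?f holomorphic_on ball 0 1"
      by (intro holomorphic_intros holo)
    have less: "cmod (?f w) < 1" if "cmod w < 1" for w
    proof -
      have "cmod (?f w) \<le> c * 1"
        using bound[OF that] c by (simp only: norm_mult norm_of_real) (intro mult_mono, auto)
      with c show ?thesis by simp
    qed
    \<comment> \<open>At the origin z cannot be divided out, but c * \<open>h 0\<close> is the
      derivative of \<open>?f\<close> there, so the derivative half of the Schwarz lemma
      applies.\<close>
    show ?thesis
    proof (cases "z = 0")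
      case True
      have "((\<lambda>w. of_real c * (w * h w)) has_field_derivative of_real c * (0 * deriv h 0 + 1 * h 0)) (at 0)"
        by (rule derivative_eq_intros holomorphic_derivI[OF holo] refl | simp)+
      then have "deriv ?f 0 = of_real c * h 0"
        by (intro DERIV_imp_deriv) simp
      with Schwarz_Lemma(2)[OF f _ less, of 0] True c show ?thesis
        by (simp add: norm_mult)
    next
      case False
      have "cmod (?f z) \<le> cmod z"
        by (rule Schwarz_Lemma(1)[OF f _ less z]) auto
      then have "c * cmod (h z) * cmod z \<le> 1 * cmod z"
        using c by (simp add: norm_mult mult_ac)
      with False show ?thesis
        by (simp only: mult_le_cancel_right) auto
    qed
  qed
  show ?thesis
  proof (rule ccontr)
    assume "\<not> ?thesis"
    then have m: "1 < cmod (h z)" by simp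
    then obtain c where c: "1 / cmod (h z) < c" "c < 1"
      using dense[of "1 / cmod (h z)" 1] by (metis divide_less_eq_1 less_trans zero_less_one)
    moreover have "0 < 1 / cmod (h z)" using m by (intro divide_pos_pos) auto
    ultimately have "0 < c" by linarith
    moreover have "1 < c * cmod (h z)" using m c(1) by (metis pos_divide_less_eq less_trans zero_less_one)
    ultimately show False using scaled[of c] c by simp
  qed
qed

lemma moebius_denominator_nonzero:
  fixes s w :: complex
  assumes "cmod s \<le> 1" "cmod w < 1"
  shows "1 + s * w \<noteq> 0"
proof
  assume "1 + s * w = 0"
  then have "s * w = - 1" by (simp add: add_eq_0_iff)
  then have "cmod s * cmod w = 1" by (metis norm_minus_cancel norm_mult norm_one)
  moreover have "cmod s * cmod w \<le> 1 * cmod w"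
    using assms by (intro mult_right_mono) auto
  ultimately show False using assms by simp
qed

text \<open>The squares differ by (1 - |s|^2) (1 - |w|^2). Comparing numerator with denominator,
  rather than bounding the quotient, also covers a vanishing denominator.\<close>

lemma moebius_bound:
  fixes s w :: complex
  assumes "cmod s \<le> 1" "cmod w \<le> 1"
  shows "cmod (s + w) \<le> cmod (1 + cnj s * w)"
proof -
  have "(cmod (1 + cnj s * w))\<^sup>2 - (cmod (s + w))\<^sup>2 = (1 - (cmod s)\<^sup>2) * (1 - (cmod w)\<^sup>2)"
    unfolding cmod_power2 by (simp add: algebra_simps power2_eq_square)
  moreover have "(1 - (cmod s)\<^sup>2) * (1 - (cmod w)\<^sup>2) \<ge> 0"
    using assms by (intro mult_nonneg_nonneg) (auto simp: power_le_one)
  ultimately show ?thesis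
    by (intro power2_le_imp_le[OF _ norm_ge_zero]) linarith
qed

text \<open>\<open>g\<close> is the Schur transform: (psi - s) / (1 - cnj s * psi) with s = psi(0)
  maps the disk into the closed disk and vanishes at 0, so it equals z g with |g| <= 1. The relation
  is stated multiplied out so that it includes |s| = 1, where psi is constant by the maximum
  principle and g = 0 serves.\<close>

lemma schur_step:
  fixes \<psi> :: "complex \<Rightarrow> complex"
  assumes holo: "\<psi> holomorphic_on ball 0 1"
    and bound: "\<And>z. cmod z < 1 \<Longrightarrow> cmod (\<psi> z) \<le> 1"
  obtains g where "g holomorphic_on ball 0 1" "\<And>z. cmod z < 1 \<Longrightarrow> cmod (g z) \<le> 1"
    "\<And>z. cmod z < 1 \<Longrightarrow> \<psi> z * (1 + cnj (\<psi> 0) * z * g z) = \<psi> 0 + z * g z"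
proof (cases "cmod (\<psi> 0) = 1")
  case True
  have "\<psi> constant_on ball 0 1"
    by (rule maximum_modulus_principle[OF holo, of "ball 0 1" 0]) (use bound True in auto)
  then obtain c where c: "\<And>z. cmod z < 1 \<Longrightarrow> \<psi> z = c"
    unfolding constant_on_def by (metis mem_ball_0)
  then show ?thesis
    by (intro that[of "\<lambda>_. 0"]) (simp_all add: c)
next
  case False
  define s where "s = \<psi> 0"
  have s: "cmod s < 1"
    using False bound[of 0] by (simp add: s_def)
  have den: "1 - cnj s * \<psi> z \<noteq> 0" if "cmod z < 1" for z
    using moebius_denominator_nonzero[of "- \<psi> z" "cnj s"] bound[OF that] s by (simp add: mult.commute)
  define h where "h z = (\<psi> z - s) / (1 - cnj s * \<psi> z)" for z
  have hh: "h holomorphic_on ball 0 1"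
    unfolding h_def by (intro holomorphic_intros holo) (use den in auto)
  have hb: "cmod (h z) \<le> 1" if "cmod z < 1" for z
    using moebius_bound[of "- s" "\<psi> z"] bound[OF that] s den[OF that]
    by (simp add: h_def norm_divide divide_le_eq norm_minus_commute)
  obtain g where g: "g holomorphic_on ball 0 1" "\<And>z. cmod z < 1 \<Longrightarrow> h z = z * g z"
    by (rule Schwarz3[OF hh]) (auto simp: h_def s_def)
  show ?thesis
  proof
    show "g holomorphic_on ball 0 1" by fact
    show "cmod (g z) \<le> 1" if "cmod z < 1" for z
      by (rule schwarz_factor_bound[OF g(1) _ that]) (simp add: hb flip: g(2))
    show "\<psi> z * (1 + cnj (\<psi> 0) * z * g z) = \<psi> 0 + z * g z" if "cmod z < 1" for z
    proof -
      have "\<psi> z - s = z * g z * (1 - cnj s * \<psi> z)"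
        using g(2)[OF that] den[OF that] by (simp add: h_def divide_eq_eq)
      then show ?thesis by (simp add: s_def[symmetric] algebra_simps)
    qed
  qed
qed

section \<open>Taylor coefficients in terms of Schur parameters\<close>

lemma holomorphic_has_fps_expansion:
  assumes "f holomorphic_on ball 0 1"
  shows "f has_fps_expansion fps_expansion f 0"
  using assms by (intro has_fps_expansion_fps_expansion[of "ball 0 1"]) auto

lemma fps_eq_of_eq_on_ball:
  fixes F G :: "complex fps"
  assumes "f has_fps_expansion F" "g has_fps_expansion G" "\<And>z. cmod z < 1 \<Longrightarrow> f z = g z"
  shows "F = G"
proof (rule fps_expansion_unique_complex[OF assms(1)])
  have "eventually (\<lambda>z. g z = f z) (nhds 0)"
    using assms(3) by (intro eventually_nhds_in_open[of "ball 0 1" 0, THEN eventually_mono]) auto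
  then show "f has_fps_expansion G"
    using assms(2) has_fps_expansion_cong[of g f G G] by simp
qed

lemma taylor_coeff_eq_fps_nth: "taylor_coeff f n = fps_nth (fps_expansion f 0) n"
  by (simp add: taylor_coeff_def fps_expansion_def)

text \<open>Compares the first three coefficients of a Schur relation. The constant \<open>c\<close>
  will be the conjugate of s, then of x, which makes 1 - c s the factors 1 - |s|^2 and 1 -
  |x|^2.\<close>

lemma schur_expansion:
  fixes s :: complex
  assumes holo: "\<psi> holomorphic_on ball 0 1" "g holomorphic_on ball 0 1"
    and eq: "\<And>z. cmod z < 1 \<Longrightarrow> \<psi> z * (1 + c * z * g z) = s + z * g z"
  defines "\<Psi> \<equiv> fps_nth (fps_expansion \<psi> 0)" and "G \<equiv> fps_nth (fps_expansion g 0)"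
  shows "\<Psi> 0 = s" "\<Psi> 1 = (1 - c * s) * G 0" "\<Psi> 2 = (1 - c * s) * (G 1 - c * (G 0)\<^sup>2)"
proof -
  let ?P = "fps_expansion \<psi> 0" and ?G = "fps_expansion g 0"
  have "?P * (1 + fps_const c * fps_X * ?G) = fps_const s + fps_X * ?G"
    by (rule fps_eq_of_eq_on_ball[where f = "\<lambda>z. \<psi> z * (1 + c * z * g z)" and g = "\<lambda>z. s + z * g z"])
       (use eq in \<open>auto intro!: fps_expansion_intros holomorphic_has_fps_expansion holo\<close>)
  then have "\<And>n. fps_nth (?P * (1 + fps_const c * fps_X * ?G)) n = fps_nth (fps_const s + fps_X * ?G) n"
    by simp
  from this[of 0] this[of 1] this[of 2]
  have e0: "\<Psi> 0 = s" and e1: "\<Psi> 0 * (c * G 0) + \<Psi> 1 = G 0"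
    and e2: "\<Psi> 0 * (c * G 1) + \<Psi> 1 * (c * G 0) + \<Psi> 2 = G 1"
    unfolding \<Psi>_def G_def
    by (simp_all add: fps_mult_nth numeral_2_eq_2 mult.assoc)
  show "\<Psi> 0 = s" by fact
  show "\<Psi> 1 = (1 - c * s) * G 0" using e0 e1 by (simp add: algebra_simps)
  then have "\<Psi> 2 = G 1 - s * (c * G 1) - (1 - c * s) * G 0 * (c * G 0)"
    using e0 e2 unfolding \<open>\<Psi> 1 = _\<close> by (simp add: algebra_simps)
  then show "\<Psi> 2 = (1 - c * s) * (G 1 - c * (G 0)\<^sup>2)"
    by (simp add: algebra_simps power2_eq_square)
qed

text \<open>The differential equation f'' = psi (2 f' + z f'') is a recursion for the coefficients
  of f in terms of those of psi. Two Schur expansions then replace the latter by s, x and the third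
  parameter \<open>k 0\<close>.\<close>

lemma coefficients_from_schur_parameters:
  fixes s x :: complex
  assumes holo: "f holomorphic_on ball 0 1" "\<psi> holomorphic_on ball 0 1" "g holomorphic_on ball 0 1"
      "k holomorphic_on ball 0 1"
    and f: "deriv f 0 = 1"
    and \<psi>: "\<And>z. cmod z < 1 \<Longrightarrow> deriv (deriv f) z = \<psi> z * (2 * deriv f z + z * deriv (deriv f) z)"
    and g: "\<And>z. cmod z < 1 \<Longrightarrow> \<psi> z * (1 + cnj s * z * g z) = s + z * g z"
    and k: "\<And>z. cmod z < 1 \<Longrightarrow> g z * (1 + cnj x * z * k z) = x + z * k z"
  defines "t \<equiv> 1 - cnj s * s"
  shows "taylor_coeff f 2 = s"
    and "3 * taylor_coeff f 3 = 3 * s\<^sup>2 + t * x"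
    and "6 * taylor_coeff f 4 = 6 * s ^ 3 + 5 * s * t * x - cnj s * t * x\<^sup>2 + t * (1 - cnj x * x) * k 0"
proof -
  let ?F = "fps_expansion f 0" and ?P = "fps_expansion \<psi> 0"
  have "fps_deriv (fps_deriv ?F) = ?P * (fps_const 2 * fps_deriv ?F + fps_X * fps_deriv (fps_deriv ?F))"
    by (rule fps_eq_of_eq_on_ball[where f = "deriv (deriv f)"
          and g = "\<lambda>z. \<psi> z * (2 * deriv f z + z * deriv (deriv f) z)"])
       (use \<psi> in \<open>auto intro!: fps_expansion_intros holomorphic_has_fps_expansion holo\<close>)
  then have "\<And>n. fps_nth (fps_deriv (fps_deriv ?F)) n
      = fps_nth (?P * (fps_const 2 * fps_deriv ?F + fps_X * fps_deriv (fps_deriv ?F))) n"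
    by simp
  note e = this[of 0] this[of 1] this[of 2]
  have F1: "fps_nth ?F 1 = 1" by (simp add: fps_expansion_def f)
  define p0 p1 p2 a2 a3 a4 where "p0 = fps_nth ?P 0" and "p1 = fps_nth ?P 1" and "p2 = fps_nth ?P 2"
    and "a2 = fps_nth ?F 2" and "a3 = fps_nth ?F 3" and "a4 = fps_nth ?F 4"
  note d = p0_def p1_def p2_def a2_def a3_def a4_def
  have "2 * a2 = 2 * p0"
    using e(1) F1 unfolding d by (simp add: numeral_2_eq_2)
  moreover have "2 * (3 * a3) = 2 * (3 * p0 * a2 + p1)"
    using e(2) F1 unfolding d
    by (simp add: fps_mult_nth numeral_2_eq_2 numeral_3_eq_3 algebra_simps)
  moreover have "2 * (6 * a4) = 2 * (6 * p0 * a3 + 3 * p1 * a2 + p2)"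
    using e(3) F1 unfolding d
    by (simp add: fps_mult_nth numeral_2_eq_2 numeral_3_eq_3 eval_nat_numeral algebra_simps)
  ultimately have e0: "a2 = p0" and e1: "3 * a3 = 3 * p0 * a2 + p1"
    and e2: "6 * a4 = 6 * p0 * a3 + 3 * p1 * a2 + p2"
    by (simp_all only: mult_cancel_left) auto
  let ?G = "fps_expansion g 0"
  have S: "p0 = s" "p1 = t * fps_nth ?G 0" "p2 = t * (fps_nth ?G 1 - cnj s * (fps_nth ?G 0)\<^sup>2)"
    unfolding d t_def using schur_expansion[OF holo(2,3), of "cnj s" s] g by blast+
  have K: "fps_nth ?G 0 = x" "fps_nth ?G 1 = (1 - cnj x * x) * fps_nth (fps_expansion k 0) 0"
    using schur_expansion[OF holo(3,4), of "cnj x" x] k by blast+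
  have P: "p0 = s" "p1 = t * x" "p2 = t * ((1 - cnj x * x) * k 0 - cnj s * x\<^sup>2)"
    unfolding S K by (simp_all add: fps_expansion_def)
  show "taylor_coeff f 2 = s"
    unfolding taylor_coeff_eq_fps_nth using e0 P(1) by (simp add: a2_def)
  have a3: "3 * a3 = 3 * s\<^sup>2 + t * x"
    unfolding e1 e0 P by (simp add: power2_eq_square)
  then show "3 * taylor_coeff f 3 = 3 * s\<^sup>2 + t * x"
    unfolding taylor_coeff_eq_fps_nth by (simp add: a3_def)
  have "6 * a4 = 2 * s * (3 * a3) + 3 * p1 * a2 + p2"
    unfolding e2 P(1) by (simp add: algebra_simps)
  also have "\<dots> = 6 * s ^ 3 + 5 * s * t * x - cnj s * t * x\<^sup>2 + t * (1 - cnj x * x) * k 0"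
    unfolding a3 e0 P by (simp add: algebra_simps power2_eq_square power3_eq_cube)
  finally show "6 * taylor_coeff f 4 = 6 * s ^ 3 + 5 * s * t * x - cnj s * t * x\<^sup>2 + t * (1 - cnj x * x) * k 0"
    unfolding taylor_coeff_eq_fps_nth by (simp add: a4_def)
qed

section \<open>A sufficient condition for convexity\<close>

lemma has_vector_derivative_on_circle:
  assumes "f holomorphic_on ball 0 1" "cmod a < 1"
  shows "((\<lambda>t. f (a * cis t)) has_vector_derivative \<i> * (a * cis t) * deriv f (a * cis t)) (at t)"
proof -
  have "((\<lambda>t. a * cis t) has_vector_derivative a * (\<i> * cis t)) (at t)"
    unfolding cis_conv_exp
    by (rule has_vector_derivative_real_field[where f = "\<lambda>w. a * exp (\<i> * w)"])
       (auto intro!: derivative_eq_intros)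
  moreover have "(f has_field_derivative deriv f (a * cis t)) (at (a * cis t))"
    using assms by (intro holomorphic_derivI[OF assms(1)]) (auto simp: norm_mult)
  ultimately have "(f \<circ> (\<lambda>t. a * cis t) has_vector_derivative a * (\<i> * cis t) * deriv f (a * cis t)) (at t)"
    by (rule field_vector_diff_chain_at)
  then show ?thesis
    by (simp add: o_def mult_ac)
qed

lemma has_real_derivative_Re_on_circle:
  assumes "f holomorphic_on ball 0 1" "cmod a < 1"
  shows "((\<lambda>t. Re (f (a * cis t))) has_real_derivative Re (\<i> * (a * cis t) * deriv f (a * cis t))) (at t)"
  unfolding has_real_derivative_iff_has_vector_derivative
  by (intro bounded_linear.has_vector_derivative[OF bounded_linear_Re] has_vector_derivative_on_circle assms)

lemma has_real_derivative_Im_on_circle: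
  assumes "f holomorphic_on ball 0 1" "cmod a < 1"
  shows "((\<lambda>t. Im (f (a * cis t))) has_real_derivative Im (\<i> * (a * cis t) * deriv f (a * cis t))) (at t)"
  unfolding has_real_derivative_iff_has_vector_derivative
  by (intro bounded_linear.has_vector_derivative[OF bounded_linear_Im] has_vector_derivative_on_circle assms)

text \<open>\<open>q\<close> is a branch of log f', so Im q supplies a continuous tangent angle
  without choosing arguments, and z q' = z f''/f'. The inequality is strict so that the tangent
  angle is strictly increasing along circles.\<close>

locale convex_criterion =
  fixes f q :: "complex \<Rightarrow> complex"
  assumes holo: "f holomorphic_on ball 0 1" "q holomorphic_on ball 0 1"
    and deriv_f: "\<And>z. cmod z < 1 \<Longrightarrow> deriv f z = exp (q z)"
    and pos: "\<And>z. cmod z < 1 \<Longrightarrow> Re (1 + z * deriv q z) > 0"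
begin

text \<open>The tangent direction \<open>T\<close> of the curve \<open>t \<mapsto> f (z0 cis t)\<close> increases strictly and gains
  exactly \<open>2 * pi\<close> in one turn, so the height of the curve over the tangent at \<open>z0\<close> first
  decreases and then increases back to 0.\<close>

lemma supporting_line_circle:
  assumes z0: "cmod z0 < 1" "z0 \<noteq> 0" and z: "cmod z = cmod z0" "z \<noteq> z0"
  shows "Re (cnj (z0 * deriv f z0) * (f z - f z0)) < 0"
proof -
  \<comment> \<open>Up to an additive constant, \<open>T\<close> is the argument of the velocity i z
    f'(z) at z = z0 cis t. \<open>l\<close> is the height in the direction of the outer normal z0
    f'(z0).\<close>
  define T where "T t = t + Im (q (z0 * cis t))" for t
  define l where "l t = Re (cnj (z0 * deriv f z0) * (f (z0 * cis t) - f z0))" for t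
  have inside: "cmod (z0 * cis t) < 1" for t
    using z0 by (simp add: norm_mult)
  have dT: "(T has_real_derivative Re (1 + z0 * cis t * deriv q (z0 * cis t))) (at t)" for t
    unfolding T_def
    using DERIV_add[OF DERIV_ident has_real_derivative_Im_on_circle[OF holo(2) z0(1), of t]]
    by (simp add: algebra_simps)
  have T_mono: "T s < T t" if "s < t" for s t
    by (rule DERIV_pos_imp_increasing[OF that]) (use dT pos[OF inside] in blast)
  \<comment> \<open>\<open>A\<close> is the modulus of the product of cnj (z0 f'(z0)) with the
    velocity; the sign of the derivative of \<open>l\<close> is therefore that of -sin (T t - T
    0).\<close>
  define A where "A t = (cmod z0)\<^sup>2 * exp (Re (q z0) + Re (q (z0 * cis t)))" for t
  have A: "A t > 0" for t
    using z0 by (simp add: A_def)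
  have dl: "(l has_real_derivative - A t * sin (T t - T 0)) (at t)" for t
  proof -
    have holo': "(\<lambda>w. cnj (z0 * deriv f z0) * (f w - f z0)) holomorphic_on ball 0 1"
      by (intro holomorphic_intros holo)
    have d: "deriv (\<lambda>w. cnj (z0 * deriv f z0) * (f w - f z0)) w = cnj (z0 * deriv f z0) * deriv f w"
      if "cmod w < 1" for w
      by (rule DERIV_imp_deriv) (rule derivative_eq_intros refl holomorphic_derivI[OF holo(1)] | simp add: that)+
    have "(l has_real_derivative Re (\<i> * (z0 * cis t) * (cnj (z0 * deriv f z0) * deriv f (z0 * cis t)))) (at t)"
      using has_real_derivative_Re_on_circle[OF holo' z0(1), of t]
      unfolding l_def by (simp only: d inside)
    moreover have "\<i> * (z0 * cis t) * (cnj (z0 * deriv f z0) * deriv f (z0 * cis t))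
        = of_real (A t) * (\<i> * cis (T t - T 0))"
    proof -
      have e: "exp w = of_real (exp (Re w)) * cis (Im w)" for w
        by (simp add: exp_eq_polar)
      have "\<i> * (z0 * cis t) * (cnj (z0 * deriv f z0) * deriv f (z0 * cis t))
        = \<i> * (z0 * cnj z0) * (cnj (exp (q z0)) * exp (q (z0 * cis t)) * cis t)"
        by (simp add: deriv_f inside z0)
      also have "cnj (exp (q z0)) * exp (q (z0 * cis t)) * cis t
        = of_real (exp (Re (q z0) + Re (q (z0 * cis t)))) * (cis (- Im (q z0)) * cis (Im (q (z0 * cis t))) * cis t)"
        by (simp add: e[of "q z0"] e[of "q (z0 * cis t)"] exp_add cis_cnj)
      also have "cis (- Im (q z0)) * cis (Im (q (z0 * cis t))) * cis t = cis (T t - T 0)"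
        by (simp add: cis_mult T_def algebra_simps)
      also have "z0 * cnj z0 = of_real ((cmod z0)\<^sup>2)"
        by (rule complex_norm_square[symmetric])
      finally show ?thesis
        by (simp add: A_def mult_ac)
    qed
    ultimately have "(l has_real_derivative Re (of_real (A t) * (\<i> * cis (T t - T 0)))) (at t)"
      by (simp only:)
    then show ?thesis by simp
  qed
  have cont: "continuous_on S l" "continuous_on S T" for S
    using dl dT by (meson DERIV_isCont continuous_at_imp_continuous_on)+
  have T2: "T (2 * pi) = T 0 + 2 * pi"
    by (simp add: T_def)
  \<comment> \<open>At \<open>u\<close> the tangent has turned by half of its total 2 pi; this is
    where the height stops decreasing and starts to increase.\<close>
  obtain u where u: "0 \<le> u" "u \<le> 2 * pi" "T u = T 0 + pi"
    using IVT'[of T 0 "T 0 + pi" "2 * pi"] cont T2 by auto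
  define t where "t = Arg2pi (z / z0)"
  have "z / z0 = cis t"
    using Arg2pi_eq[of "z / z0"] z z0 by (simp add: t_def norm_divide cis_conv_exp)
  then have zt: "z = z0 * cis t"
    using z0 by (simp add: field_simps)
  have t: "0 < t" "t < 2 * pi"
  proof -
    have "t \<noteq> 0" using zt z by auto
    then show "0 < t" using Arg2pi_ge_0[of "z / z0"] by (simp add: t_def)
    show "t < 2 * pi" unfolding t_def by (rule Arg2pi_lt_2pi)
  qed
  have "l t < 0"
  proof (cases "t \<le> u")
    case True
    have "l t < l 0"
    proof (rule DERIV_neg_imp_decreasing_open[OF t(1) _ cont(1)])
      fix x assume x: "0 < x" "x < t"
      have "0 < sin (T x - T 0)"
        using T_mono[of 0 x] T_mono[of x u] x True u(3) by (intro sin_gt_zero) auto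
      then show "\<exists>y. (l has_real_derivative y) (at x) \<and> y < 0"
        using dl A[of x] by (intro exI[of _ "- A x * sin (T x - T 0)"]) auto
    qed
    then show ?thesis by (simp add: l_def)
  next
    case False
    have "l t < l (2 * pi)"
    proof (rule DERIV_pos_imp_increasing_open[OF t(2) _ cont(1)])
      fix x assume x: "t < x" "x < 2 * pi"
      have "0 < sin (T x - T 0 - pi)"
        using T_mono[of u x] T_mono[of x "2 * pi"] x False u(3) T2 by (intro sin_gt_zero) auto
      then have "sin (T x - T 0) < 0"
        by (simp add: sin_diff)
      then show "\<exists>y. (l has_real_derivative y) (at x) \<and> y > 0"
        using dl A[of x] by (intro exI[of _ "- A x * sin (T x - T 0)"]) (auto simp: mult_pos_neg)
    qed
    then show ?thesis by (simp add: l_def)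
  qed
  then show ?thesis by (simp add: l_def zt)
qed

text \<open>The height is the real part of a holomorphic function, so the maximum principle carries
  the inequality from the circle to the closed disk.\<close>

lemma supporting_line_le:
  assumes z0: "cmod z0 < 1" "z0 \<noteq> 0" and z: "cmod z \<le> cmod z0"
  shows "Re (cnj (z0 * deriv f z0) * (f z - f z0)) \<le> 0"
proof (rule maximum_real_frontier[where f = "\<lambda>z. cnj (z0 * deriv f z0) * (f z - f z0)"
      and S = "cball 0 (cmod z0)"])
  have sub: "cball 0 (cmod z0) \<subseteq> ball 0 1"
    using z0 by auto
  show "(\<lambda>z. cnj (z0 * deriv f z0) * (f z - f z0)) holomorphic_on interior (cball 0 (cmod z0))"
    by (intro holomorphic_intros holomorphic_on_subset[OF holo(1)]) (use sub interior_subset in blast)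
  show "continuous_on (closure (cball 0 (cmod z0))) (\<lambda>z. cnj (z0 * deriv f z0) * (f z - f z0))"
    using sub by (intro continuous_intros holomorphic_on_imp_continuous_on holomorphic_on_subset[OF holo(1)]) simp
  show "Re (cnj (z0 * deriv f z0) * (f w - f z0)) \<le> 0" if "w \<in> frontier (cball 0 (cmod z0))" for w
    using supporting_line_circle[OF z0, of w] that by (cases "w = z0") (auto simp: frontier_cball)
qed (use z in auto)

lemma open_image_ball:
  assumes "r \<le> 1"
  shows "open (f ` ball 0 r)"
proof (rule open_mapping_thm[OF holo(1)])
  show "\<not> f constant_on ball 0 1"
  proof
    assume "f constant_on ball 0 1"
    then obtain c where c: "\<And>z. z \<in> ball 0 1 \<Longrightarrow> f z = c"
      by (auto simp: constant_on_def)
    have "(f has_field_derivative 0) (at 0)"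
      by (rule has_field_derivative_transform_within_open[of "\<lambda>_. c" _ _ "ball 0 1"]) (auto simp: c)
    then show False
      using deriv_f[of 0] DERIV_imp_deriv by fastforce
  qed
qed (use assms in auto)

text \<open>If f z lay on the tangent, openness of the image would allow a small shift of f z along
  the outer normal that stays in the image of the open disk and crosses the tangent, against the
  weak inequality.\<close>

lemma supporting_line_less:
  assumes z0: "cmod z0 < 1" and z: "cmod z < cmod z0"
  shows "Re (cnj (z0 * deriv f z0) * (f z - f z0)) < 0"
proof (rule ccontr)
  assume neg: "\<not> ?thesis"
  define n where "n = z0 * deriv f z0"
  have nz: "z0 \<noteq> 0" using z by auto
  have n: "n \<noteq> 0" using nz deriv_f[OF z0] by (simp add: n_def)
  have "open (f ` ball 0 (cmod z0))" using z0 by (intro open_image_ball) auto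
  then obtain e where e: "e > 0" "cball (f z) e \<subseteq> f ` ball 0 (cmod z0)"
    using z open_contains_cball by (metis imageI mem_ball_0)
  define w where "w = f z + of_real (e / cmod n) * n"
  have "w \<in> cball (f z) e"
    using e n by (simp add: w_def dist_norm norm_mult norm_divide)
  with e obtain y where y: "cmod y < cmod z0" "w = f y" by auto
  have "Re (cnj n * (w - f z0)) \<le> 0"
    using supporting_line_le[OF z0 nz, of y] y by (simp add: n_def)
  moreover have "Re (cnj n * (w - f z0)) = Re (cnj n * (f z - f z0)) + e / cmod n * (cmod n)\<^sup>2"
    unfolding cmod_power2 by (simp add: w_def algebra_simps power2_eq_square add_divide_distrib)
  moreover have "e / cmod n * (cmod n)\<^sup>2 > 0"
    using e n by simp
  ultimately show False using neg by (simp add: n_def)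
qed

text \<open>Take the tangent at the point of larger modulus: every other point of that closed disk
  is mapped strictly below it, hence to a different value.\<close>

lemma injective: "inj_on f (ball 0 1)"
proof -
  have ne: "f z \<noteq> f w" if "cmod w < 1" "cmod z \<le> cmod w" "z \<noteq> w" for z w
  proof (cases "cmod z = cmod w")
    case True
    then show ?thesis
      using supporting_line_circle[of w z] that by (cases "w = 0") auto
  next
    case False
    then show ?thesis
      using supporting_line_less[of w z] that by auto
  qed
  show ?thesis
    unfolding inj_on_def using ne by (metis linear mem_ball_0)
qed

text \<open>Suppose c lies on a chord of the image but outside it. The segment from f 0 to c leaves
  the image at some e. The half-plane bounded by the tangent at e contains the chord, hence c, and
  contains f 0 in its interior; so e, between f 0 and c, would lie strictly below its own
  tangent.\<close>

lemma convex_image_cball: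
  assumes r: "0 < r" "r < 1"
  shows "convex (f ` cball 0 r)"
proof (rule ccontr)
  let ?C = "f ` cball 0 r"
  assume "\<not> convex ?C"
  then obtain a b c where ab: "a \<in> ?C" "b \<in> ?C" and c: "c \<in> closed_segment a b" "c \<notin> ?C"
    unfolding convex_contains_segment by blast
  then obtain z1 z2 where z12: "cmod z1 \<le> r" "cmod z2 \<le> r" "a = f z1" "b = f z2"
    by auto
  have sub: "cball 0 r \<subseteq> ball 0 1" using r by auto
  have "compact ?C"
    by (intro compact_continuous_image holomorphic_on_imp_continuous_on holomorphic_on_subset[OF holo(1)] sub) simp
  then have "closed ?C" by (rule compact_imp_closed)
  have "closed_segment (f 0) c \<inter> frontier ?C \<noteq> {}"
  proof (rule connected_Int_frontier)
    show "closed_segment (f 0) c \<inter> ?C \<noteq> {}" using r by force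
    show "closed_segment (f 0) c - ?C \<noteq> {}" using c by auto
  qed auto
  then obtain e where e: "e \<in> closed_segment (f 0) c" "e \<in> frontier ?C" by auto
  then have "e \<in> ?C" using \<open>closed ?C\<close> frontier_subset_closed by blast
  then obtain z0 where z0: "cmod z0 \<le> r" "e = f z0" by auto
  \<comment> \<open>Tangents are available on the circle of radius r only; an interior preimage
    would put e into an open subset of the image.\<close>
  have "cmod z0 = r"
  proof (rule ccontr)
    assume "cmod z0 \<noteq> r"
    with z0 have "e \<in> f ` ball 0 r" by auto
    moreover have "f ` ball 0 r \<subseteq> interior ?C"
      using open_image_ball[of r] r by (intro interior_maximal image_mono) auto
    ultimately show False using e by (auto simp: frontier_def)
  qed
  define n where "n = cnj (z0 * deriv f z0)"
  have L: "Re (n * (f z - e)) \<le> 0" if "cmod z \<le> r" for z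
    using supporting_line_le[of z0 z] \<open>cmod z0 = r\<close> r that z0 by (cases "z0 = 0") (auto simp: n_def)
  have L0: "Re (n * (f 0 - e)) < 0"
    using supporting_line_less[of z0 0] \<open>cmod z0 = r\<close> r z0 by (auto simp: n_def)
  obtain v where v: "0 \<le> v" "v \<le> 1" "c = (1 - v) *\<^sub>R f z1 + v *\<^sub>R f z2"
    using c z12 by (auto simp: closed_segment_def)
  have "n * (c - e) = (1 - v) *\<^sub>R (n * (f z1 - e)) + v *\<^sub>R (n * (f z2 - e))"
    unfolding v(3) by (simp add: algebra_simps scaleR_conv_of_real)
  then have "Re (n * (c - e)) = (1 - v) * Re (n * (f z1 - e)) + v * Re (n * (f z2 - e))"
    by simp
  then have Lc: "Re (n * (c - e)) \<le> 0"
    using v L z12 by (simp add: add_nonpos_nonpos mult_nonneg_nonpos)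
  obtain u where u: "0 \<le> u" "u \<le> 1" "e = (1 - u) *\<^sub>R f 0 + u *\<^sub>R c"
    using e by (auto simp: closed_segment_def)
  \<comment> \<open>This leaves the strict inequality at f 0 a positive weight.\<close>
  have "u \<noteq> 1" using u c \<open>e \<in> ?C\<close> by auto
  have "(1 - u) *\<^sub>R (n * (f 0 - e)) + u *\<^sub>R (n * (c - e)) = n * ((1 - u) *\<^sub>R f 0 + u *\<^sub>R c - e)"
    by (simp add: algebra_simps scaleR_conv_of_real)
  also have "\<dots> = 0" using u(3) by simp
  finally have "Re ((1 - u) *\<^sub>R (n * (f 0 - e)) + u *\<^sub>R (n * (c - e))) = 0"
    by (simp only: zero_complex.sel)
  then have "(1 - u) * Re (n * (f 0 - e)) + u * Re (n * (c - e)) = 0"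
    by (simp only: plus_complex.sel scaleR_complex.sel)
  moreover have "(1 - u) * Re (n * (f 0 - e)) < 0"
    using L0 u \<open>u \<noteq> 1\<close> by (intro mult_pos_neg) auto
  moreover have "u * Re (n * (c - e)) \<le> 0"
    using Lc u by (intro mult_nonneg_nonpos) auto
  ultimately show False by linarith
qed

lemma convex_image: "convex (f ` ball 0 1)"
  unfolding convex_contains_segment
proof (intro ballI)
  fix a b assume "a \<in> f ` ball 0 1" "b \<in> f ` ball 0 1"
  then obtain z w where zw: "a = f z" "b = f w" "cmod z < 1" "cmod w < 1" by auto
  define r where "r = (1 + max (cmod z) (cmod w)) / 2"
  have r: "cmod z \<le> r" "cmod w \<le> r" "0 < r" "r < 1"
    using zw by (auto simp: r_def max_def intro: add_pos_nonneg)
  have "closed_segment a b \<subseteq> f ` cball 0 r"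
    using convex_image_cball[OF r(3,4)] zw r by (intro closed_segment_subset) auto
  also have "\<dots> \<subseteq> f ` ball 0 1" using r by (intro image_mono) auto
  finally show "closed_segment a b \<subseteq> f ` ball 0 1" .
qed

end

text \<open>The weak hypothesis suffices for the strict criterion: multiplying it by |z| < 1 gives
  |w| < |2 + w| for w = z f''/f', once 2 + w = 0 is excluded.\<close>

lemma convK_criterion:
  fixes f :: "complex \<Rightarrow> complex"
  assumes holo: "f holomorphic_on ball 0 1" and norm: "f 0 = 0" "deriv f 0 = 1"
    and nz: "\<And>z. cmod z < 1 \<Longrightarrow> deriv f z \<noteq> 0"
    and bound: "\<And>z. cmod z < 1 \<Longrightarrow> cmod (deriv (deriv f) z) \<le> cmod (2 * deriv f z + z * deriv (deriv f) z)"
  shows "f \<in> convK"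
proof -
  have holo': "deriv f holomorphic_on ball 0 1" using holo by (intro holomorphic_deriv) auto
  obtain q where q: "q holomorphic_on ball 0 1" "\<And>z. z \<in> ball 0 1 \<Longrightarrow> deriv f z = exp (q z)"
    by (rule contractible_imp_holomorphic_log[OF holo' convex_imp_contractible[OF convex_ball]])
       (use nz in auto)
  interpret convex_criterion f q
  proof
    fix z :: complex assume z: "cmod z < 1"
    have d2: "deriv (deriv f) z = deriv q z * exp (q z)"
    proof (rule DERIV_imp_deriv, rule has_field_derivative_transform_within_open[where S = "ball 0 1"])
      show "((\<lambda>z. exp (q z)) has_field_derivative deriv q z * exp (q z)) (at z)"
        using z by (auto intro!: derivative_eq_intros holomorphic_derivI[OF q(1)])
    qed (use z q in auto)
    define w where "w = z * deriv q z"
    have "2 * deriv f z + z * deriv (deriv f) z = (2 + w) * exp (q z)"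
      using q(2)[of z] z by (simp add: d2 w_def algebra_simps)
    then have b: "cmod (deriv q z) \<le> cmod (2 + w)"
      using bound[OF z] by (simp add: d2 norm_mult)
    have "2 + w \<noteq> 0"
    proof
      assume "2 + w = 0"
      with b have "w = 0" by (simp add: w_def)
      with \<open>2 + w = 0\<close> show False by simp
    qed
    have "cmod w \<le> cmod z * cmod (2 + w)"
      using b by (simp add: w_def norm_mult mult_left_mono)
    also have "\<dots> < 1 * cmod (2 + w)"
      using z \<open>2 + w \<noteq> 0\<close> by (intro mult_strict_right_mono) auto
    finally have "(cmod w)\<^sup>2 < (cmod (2 + w))\<^sup>2"
      by (intro power_strict_mono) auto
    then show "Re (1 + z * deriv q z) > 0"
      unfolding cmod_power2 w_def[symmetric] by (simp add: power2_eq_square algebra_simps)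
  qed (use holo q in auto)
  show ?thesis
    unfolding convK_def using holo norm injective convex_image by simp
qed

section \<open>Necessity of the curvature condition\<close>

text \<open>Since H has a double zero at 0, dividing by t leaves h with h 0 = 0 and H / t^2 = h / t,
  which tends to h'(0). Differentiating H' = h + t h' at 0 gives D = 2 h'(0).\<close>

lemma second_order_limit:
  fixes H :: "complex \<Rightarrow> complex"
  assumes H: "H holomorphic_on ball 0 r" "0 < r" "H 0 = 0"
    and H': "\<And>t. cmod t < r \<Longrightarrow> (H has_field_derivative H' t) (at t)" "H' 0 = 0"
    and H'': "(H' has_field_derivative D) (at 0)"
  shows "((\<lambda>t. H t / t\<^sup>2) \<longlongrightarrow> D / 2) (at 0)"
proof -
  obtain h where h: "h holomorphic_on ball 0 r" "\<And>t. cmod t < r \<Longrightarrow> H t = t * h t" "deriv H 0 = h 0"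
    using Schwarz3[OF H(1,3)] by blast
  have "deriv H 0 = 0"
    using H'(1)[of 0] H'(2) H(2) DERIV_imp_deriv by force
  then have h0: "h 0 = 0" using h(3) by simp
  have dh: "(h has_field_derivative deriv h t) (at t)" if "cmod t < r" for t
    using that by (intro holomorphic_derivI[OF h(1)]) auto
  have H'_eq: "h t + t * deriv h t = H' t" if "cmod t < r" for t
  proof -
    have "((\<lambda>t. t * h t) has_field_derivative h t + t * deriv h t) (at t)"
      using dh[OF that] by (auto intro!: derivative_eq_intros)
    then have "(H has_field_derivative h t + t * deriv h t) (at t)"
      by (rule has_field_derivative_transform_within_open[where S = "ball 0 r"]) (use that h(2) in auto)
    with H'(1)[OF that] show ?thesis by (rule DERIV_unique[symmetric])
  qed
  have dh2: "(deriv h has_field_derivative deriv (deriv h) 0) (at 0)"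
    using H(2) by (intro holomorphic_derivI[OF holomorphic_deriv[OF h(1)]]) auto
  have "((\<lambda>t. h t + t * deriv h t) has_field_derivative 2 * deriv h 0) (at 0)"
    by (rule derivative_eq_intros dh dh2 refl | simp add: H(2))+
  then have "(H' has_field_derivative 2 * deriv h 0) (at 0)"
    by (rule has_field_derivative_transform_within_open[where S = "ball 0 r"]) (use H(2) H'_eq in auto)
  with H'' have D: "D = 2 * deriv h 0" by (rule DERIV_unique)
  have "((\<lambda>t. h t / t) \<longlongrightarrow> deriv h 0) (at 0)"
    using dh[of 0] H(2) h0 by (simp add: has_field_derivative_iff)
  moreover have "\<forall>\<^sub>F t in at 0. h t / t = H t / t\<^sup>2"
    using eventually_at_in_open[of "ball 0 r" 0] H(2)
    by (auto elim!: eventually_mono simp: h(2) power2_eq_square)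
  ultimately show ?thesis
    unfolding D by (simp add: filterlim_cong)
qed

text \<open>This is the symmetric second difference of u(t) = f (z exp (i t)): the first order
  cancels and u''(0)/2 remains, where u''(0) = -z (f' + z f'').\<close>

lemma rotation_average_limit:
  assumes f: "f holomorphic_on ball 0 1" and z: "cmod z < 1"
  shows "((\<lambda>t. ((f (z * cis t) + f (z * cis (- t))) / 2 - f z) / of_real (t\<^sup>2)) \<longlongrightarrow>
     - z * (deriv f z + z * deriv (deriv f) z) / 2) (at 0)"
proof -
  \<comment> \<open>The angle is made complex, so that the limit can be taken for a holomorphic
    function of t and restricted to real t afterwards.\<close>
  define e where "e t = z * exp (\<i> * t)" for t :: complex
  have "open (e -` ball 0 1)"
    unfolding e_def by (intro open_vimage continuous_intros) auto
  moreover have "0 \<in> e -` ball 0 1"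
    using z by (simp add: e_def)
  ultimately obtain r where "r > 0" "ball 0 r \<subseteq> e -` ball 0 1"
    by (rule openE)
  then have r: "r > 0" "\<And>t. cmod t < r \<Longrightarrow> cmod (e t) < 1"
    by (auto simp: subset_iff)
  define v where "v t = deriv f (e t) * (\<i> * e t)" for t
  define H where "H t = (f (e t) + f (e (- t))) / 2 - f z" for t
  define H' where "H' t = (v t - v (- t)) / 2" for t
  have de: "(e has_field_derivative \<i> * e t) (at t)" for t
    unfolding e_def by (auto intro!: derivative_eq_intros)
  have dfe: "((\<lambda>t. f (e t)) has_field_derivative v t) (at t)" if "cmod t < r" for t
    unfolding v_def using r(2)[OF that]
    by (intro DERIV_chain2[OF holomorphic_derivI[OF f] de]) auto
  have dfe': "((\<lambda>t. f (e (- t))) has_field_derivative - v (- t)) (at t)" if "cmod t < r" for t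
    using DERIV_chain2[OF dfe[of "- t"] DERIV_minus[OF DERIV_ident]] that by simp
  have dH: "(H has_field_derivative H' t) (at t)" if "cmod t < r" for t
    unfolding H_def H'_def
    by (rule derivative_eq_intros dfe[OF that] dfe'[OF that] refl | simp)+
  have dv: "(v has_field_derivative - z * (deriv f z + z * deriv (deriv f) z)) (at 0)"
  proof -
    have "(deriv f has_field_derivative deriv (deriv f) (e 0)) (at (e 0))"
      using z by (intro holomorphic_derivI[OF holomorphic_deriv[OF f]]) (auto simp: e_def)
    from DERIV_mult[OF DERIV_chain2[OF this de] DERIV_cmult[OF de, of \<i>]]
    show ?thesis unfolding v_def by (rule DERIV_cong) (simp add: e_def algebra_simps power2_eq_square)
  qed
  have dv': "((\<lambda>t. v (- t)) has_field_derivative z * (deriv f z + z * deriv (deriv f) z)) (at 0)"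
    using DERIV_chain2[OF _ DERIV_minus[OF DERIV_ident], of v _ 0] dv
    by (metis (no_types, lifting) minus_zero mult_minus1_right minus_mult_left minus_minus)
  have "((\<lambda>t. H t / t\<^sup>2) \<longlongrightarrow> - z * (deriv f z + z * deriv (deriv f) z) / 2) (at 0)"
  proof (rule second_order_limit[OF _ r(1) _ dH])
    show "H holomorphic_on ball 0 r"
      unfolding holomorphic_on_open[OF open_ball] using dH by (metis mem_ball_0)
    show "(H' has_field_derivative - z * (deriv f z + z * deriv (deriv f) z)) (at 0)"
      unfolding H'_def by (rule derivative_eq_intros dv dv' refl | simp)+
  qed (auto simp: H_def H'_def e_def)
  moreover have "filterlim complex_of_real (at 0) (at 0)"
    by (auto simp: filterlim_at eventually_at_filter intro!: tendsto_eq_intros)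
  ultimately have "((\<lambda>t. H (of_real t) / (of_real t)\<^sup>2) \<longlongrightarrow>
      - z * (deriv f z + z * deriv (deriv f) z) / 2) (at (0::real))"
    by (rule filterlim_compose)
  then show ?thesis
    by (simp add: H_def e_def cis_conv_exp)
qed

text \<open>The average of two rotations of a convex map is subordinate to the map itself; letting the
  rotation angle tend to zero in the Schwarz lemma turns this into the curvature condition.\<close>

lemma convK_curvature:
  assumes "f \<in> convK" and z: "cmod z < 1"
  shows "Re (1 + z * deriv (deriv f) z / deriv f z) \<ge> 0"
proof (cases "z = 0")
  case False
  have f: "f holomorphic_on ball 0 1" "inj_on f (ball 0 1)" "f 0 = 0" "convex (f ` ball 0 1)"
    using assms by (auto simp: convK_def)
  obtain g where g: "g holomorphic_on f ` ball 0 1"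
      "\<And>z. z \<in> ball 0 1 \<Longrightarrow> deriv f z * deriv g (f z) = 1" "\<And>z. z \<in> ball 0 1 \<Longrightarrow> g (f z) = z"
    using holomorphic_has_inverse[OF f(1) open_ball f(2)] by blast
  have nz: "deriv f z \<noteq> 0"
    using g(2)[of z] z by auto
  have op: "open (f ` ball 0 1)"
    using open_mapping_thm3[OF f(1) open_ball f(2)] .
  define F where "F \<zeta> t = (f (\<zeta> * cis t) + f (\<zeta> * cis (- t))) / 2" for \<zeta> t
  have F: "F \<zeta> t \<in> f ` ball 0 1" if "cmod \<zeta> < 1" for \<zeta> t
  proof -
    have "F \<zeta> t = (1/2) *\<^sub>R f (\<zeta> * cis t) + (1/2) *\<^sub>R f (\<zeta> * cis (- t))"
      by (simp add: F_def scaleR_conv_of_real add_divide_distrib)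
    also have "\<dots> \<in> f ` ball 0 1"
      using that by (intro convexD[OF f(4)] imageI) (auto simp: norm_mult)
    finally show ?thesis .
  qed
  \<comment> \<open>By convexity the average stays in the image, so pulling it back by the inverse
    \<open>g\<close> yields a self-map of the disk that fixes 0.\<close>
  have sub: "cmod (g (F z t)) \<le> cmod z" for t
  proof (rule Schwarz_Lemma(1)[where f = "\<lambda>\<zeta>. g (F \<zeta> t)", OF _ _ _ z])
    have "(\<lambda>\<zeta>. F \<zeta> t) holomorphic_on ball 0 1"
      unfolding F_def
      by (intro holomorphic_intros holomorphic_on_compose_gen[OF _ f(1), unfolded o_def])
         (auto simp: norm_mult)
    then show "(\<lambda>\<zeta>. g (F \<zeta> t)) holomorphic_on ball 0 1"
      using holomorphic_on_compose_gen[OF _ g(1), unfolded o_def] F by (auto simp: image_subset_iff)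
    show "g (F 0 t) = 0" using g(3)[of 0] f(3) by (simp add: F_def)
    show "cmod (g (F \<zeta> t)) < 1" if "cmod \<zeta> < 1" for \<zeta>
      using F[OF that, of t] g(3) by auto
  qed
  define L where "L = - z * (deriv f z + z * deriv (deriv f) z) / 2"
  have lim: "((\<lambda>t. (F z t - f z) / of_real (t\<^sup>2)) \<longlongrightarrow> L) (at 0)"
    unfolding F_def L_def by (rule rotation_average_limit[OF f(1) z])
  have "((\<lambda>t. (F z t - f z) / of_real (t\<^sup>2) * of_real (t\<^sup>2)) \<longlongrightarrow> 0) (at 0)"
    by (rule tendsto_eq_intros lim refl | simp)+
  then have "((\<lambda>t. F z t - f z) \<longlongrightarrow> 0) (at 0)"
    by (rule Lim_transform_eventually) (auto simp: eventually_at_filter)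
  then have limF: "((\<lambda>t. F z t) \<longlongrightarrow> f z) (at 0)"
    by (simp add: Lim_null[symmetric])
  have "deriv g (f z) = 1 / deriv f z"
    using g(2)[of z] z nz by (simp add: field_simps)
  then have "(g has_field_derivative 1 / deriv f z) (at (f z))"
    using holomorphic_derivI[OF g(1) op, of "f z"] z by simp
  \<comment> \<open>Caratheodory's slope function \<open>\<gamma>\<close> replaces the difference
    quotient of g, whose denominator F z t - f z may vanish.\<close>
  then obtain \<gamma> where \<gamma>: "\<And>w. g w - g (f z) = \<gamma> w * (w - f z)" "isCont \<gamma> (f z)" "\<gamma> (f z) = 1 / deriv f z"
    unfolding CARAT_DERIV by blast
  have "((\<lambda>t. \<gamma> (F z t) * ((F z t - f z) / of_real (t\<^sup>2))) \<longlongrightarrow> 1 / deriv f z * L) (at 0)"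
    using isCont_tendsto_compose[OF \<gamma>(2) limF] \<gamma>(3) by (intro tendsto_mult lim) simp
  then have "((\<lambda>t. (g (F z t) - z) / of_real (t\<^sup>2)) \<longlongrightarrow> 1 / deriv f z * L) (at 0)"
    using \<gamma>(1) g(3)[of z] z by (simp add: mult.assoc[symmetric])
  then have "((\<lambda>t. Re (cnj z * ((g (F z t) - z) / of_real (t\<^sup>2)))) \<longlongrightarrow> Re (cnj z * (1 / deriv f z * L))) (at 0)"
    by (intro tendsto_intros)
  \<comment> \<open>The point g (F z t) stays in the closed disk of radius |z|, so its displacement
    from the boundary point z has no outward component.\<close>
  moreover have "\<forall>\<^sub>F t in at (0::real). Re (cnj z * ((g (F z t) - z) / of_real (t\<^sup>2))) \<le> 0"
  proof (rule always_eventually, rule allI)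
    fix t :: real
    have "Re (cnj z * g (F z t)) \<le> cmod z * cmod (g (F z t))"
      using complex_Re_le_cmod[of "cnj z * g (F z t)"] by (simp add: norm_mult)
    also have "\<dots> \<le> cmod z * cmod z"
      using sub by (intro mult_left_mono) auto
    also have "\<dots> = Re (cnj z * z)"
      using cmod_power2[of z] by (simp add: power2_eq_square)
    finally have "Re (cnj z * (g (F z t) - z)) \<le> 0"
      by (simp add: algebra_simps)
    moreover have "cnj z * ((g (F z t) - z) / of_real (t\<^sup>2)) = cnj z * (g (F z t) - z) / of_real (t\<^sup>2)"
      by simp
    ultimately show "Re (cnj z * ((g (F z t) - z) / of_real (t\<^sup>2))) \<le> 0"
      by (simp only: Re_divide_of_real divide_nonpos_nonneg zero_le_power2)
  qed
  ultimately have "Re (cnj z * (1 / deriv f z * L)) \<le> 0"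
    by (intro tendsto_upperbound) auto
  moreover have "cnj z * (1 / deriv f z * L) = of_real (- (cmod z)\<^sup>2 / 2) * (1 + z * deriv (deriv f) z / deriv f z)"
    using nz complex_norm_square[of z] by (simp add: L_def field_simps)
  ultimately have "(cmod z)\<^sup>2 * Re (1 + z * deriv (deriv f) z / deriv f z) \<ge> 0"
    by simp
  with False show ?thesis
    by (simp add: zero_le_mult_iff)
qed auto

text \<open>The map w / (2 + w) takes the half-plane Re (1 + w) >= 0 into the closed unit disk. For
  w = z f''/f' its value is z psi(z), so curvature bounds only z psi; the Schwarz lemma removes the
  factor z.\<close>

lemma convK_schur_function:
  assumes "f \<in> convK"
  obtains \<psi> where "\<psi> holomorphic_on ball 0 1" "\<And>z. cmod z < 1 \<Longrightarrow> cmod (\<psi> z) \<le> 1"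
    "\<And>z. cmod z < 1 \<Longrightarrow> deriv (deriv f) z = \<psi> z * (2 * deriv f z + z * deriv (deriv f) z)"
proof -
  have f: "f holomorphic_on ball 0 1" "inj_on f (ball 0 1)"
    using assms by (auto simp: convK_def)
  define \<psi> where "\<psi> z = deriv (deriv f) z / (2 * deriv f z + z * deriv (deriv f) z)" for z
  have key: "2 * deriv f z + z * deriv (deriv f) z \<noteq> 0"
    "cmod (z * deriv (deriv f) z) \<le> cmod (2 * deriv f z + z * deriv (deriv f) z)" if z: "cmod z < 1" for z
  proof -
    define w where "w = z * deriv (deriv f) z / deriv f z"
    have nz: "deriv f z \<noteq> 0"
      using holomorphic_injective_imp_regular[OF f(1) open_ball f(2), of z] z by auto
    have w: "Re (1 + w) \<ge> 0"
      unfolding w_def by (rule convK_curvature[OF assms z])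
    have eq: "2 * deriv f z + z * deriv (deriv f) z = deriv f z * (2 + w)"
      "z * deriv (deriv f) z = deriv f z * w"
      using nz by (simp_all add: w_def field_simps)
    have "2 + w \<noteq> 0"
    proof
      assume "2 + w = 0"
      then have "Re (2 + w) = 0" by simp
      with w show False by simp
    qed
    then show "2 * deriv f z + z * deriv (deriv f) z \<noteq> 0"
      unfolding eq(1) using nz by simp
    have "(cmod (2 + w))\<^sup>2 - (cmod w)\<^sup>2 = 4 * Re (1 + w)"
      unfolding cmod_power2 by (simp add: power2_eq_square algebra_simps)
    then have "cmod w \<le> cmod (2 + w)"
      using w by (intro power2_le_imp_le[OF _ norm_ge_zero]) linarith
    then show "cmod (z * deriv (deriv f) z) \<le> cmod (2 * deriv f z + z * deriv (deriv f) z)"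
      unfolding eq(1) unfolding eq(2) norm_mult by (intro mult_left_mono) auto
  qed
  have holo: "\<psi> holomorphic_on ball 0 1"
    unfolding \<psi>_def using key(1) by (intro holomorphic_intros holomorphic_deriv f) auto
  show ?thesis
  proof
    show "\<psi> holomorphic_on ball 0 1" by fact
    show "cmod (\<psi> z) \<le> 1" if "cmod z < 1" for z
    proof (rule schwarz_factor_bound[OF holo _ that])
      fix w :: complex assume "cmod w < 1"
      from key[OF this] show "cmod (w * \<psi> w) \<le> 1"
        by (simp add: \<psi>_def norm_mult norm_divide divide_le_eq)
    qed
    show "deriv (deriv f) z = \<psi> z * (2 * deriv f z + z * deriv (deriv f) z)" if "cmod z < 1" for z
      using key(1)[OF that] by (simp add: \<psi>_def)
  qed
qed

text \<open>Solving the relation for f''/f' gives 2 psi / (1 - z psi), which is holomorphic on the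
  disk. Integrating, exponentiating and integrating again produces f; the constants
  \<open>Q 0\<close> and \<open>G 0\<close> normalise it.\<close>

lemma convK_of_schur_function:
  fixes \<psi> :: "complex \<Rightarrow> complex"
  assumes holo: "\<psi> holomorphic_on ball 0 1" and bound: "\<And>z. cmod z < 1 \<Longrightarrow> cmod (\<psi> z) \<le> 1"
  obtains f where "f \<in> convK"
    "\<And>z. cmod z < 1 \<Longrightarrow> deriv (deriv f) z = \<psi> z * (2 * deriv f z + z * deriv (deriv f) z)"
proof -
  have den: "1 - z * \<psi> z \<noteq> 0" if "cmod z < 1" for z
    using moebius_denominator_nonzero[of "- \<psi> z" z] bound[OF that] that by (simp add: mult.commute)
  have "(\<lambda>z. 2 * \<psi> z / (1 - z * \<psi> z)) holomorphic_on ball 0 1"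
    using den by (intro holomorphic_intros holo) auto
  then obtain Q where "\<And>z. z \<in> ball 0 1 \<Longrightarrow> (Q has_field_derivative 2 * \<psi> z / (1 - z * \<psi> z)) (at z within ball 0 1)"
    using holomorphic_convex_primitive'[OF convex_ball open_ball] by blast
  then have Q: "(Q has_field_derivative 2 * \<psi> z / (1 - z * \<psi> z)) (at z)" if "cmod z < 1" for z
    using that by (metis at_within_open mem_ball_0 open_ball)
  define E where "E z = exp (Q z - Q 0)" for z
  have dE: "(E has_field_derivative E z * (2 * \<psi> z / (1 - z * \<psi> z))) (at z)" if "cmod z < 1" for z
    unfolding E_def by (rule derivative_eq_intros Q[OF that] refl | simp)+
  have "E holomorphic_on ball 0 1"
    unfolding holomorphic_on_open[OF open_ball] using dE by (metis mem_ball_0)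
  then obtain G where "\<And>z. z \<in> ball 0 1 \<Longrightarrow> (G has_field_derivative E z) (at z within ball 0 1)"
    using holomorphic_convex_primitive'[OF convex_ball open_ball] by blast
  then have G: "(G has_field_derivative E z) (at z)" if "cmod z < 1" for z
    using that by (metis at_within_open mem_ball_0 open_ball)
  define f where "f z = G z - G 0" for z
  have df: "(f has_field_derivative E z) (at z)" if "cmod z < 1" for z
    unfolding f_def by (rule derivative_eq_intros G[OF that] refl | simp)+
  have d1: "deriv f z = E z" if "cmod z < 1" for z
    using DERIV_imp_deriv[OF df[OF that]] .
  have d2: "deriv (deriv f) z = E z * (2 * \<psi> z / (1 - z * \<psi> z))" if "cmod z < 1" for z
    by (rule DERIV_imp_deriv, rule has_field_derivative_transform_within_open[OF dE[OF that], where S = "ball 0 1"])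
       (use d1 that in auto)
  have ode: "deriv (deriv f) z = \<psi> z * (2 * deriv f z + z * deriv (deriv f) z)" if "cmod z < 1" for z
    unfolding d1[OF that] d2[OF that] using den[OF that] by (simp add: field_simps)
  have "f \<in> convK"
  proof (rule convK_criterion)
    show "f holomorphic_on ball 0 1" unfolding holomorphic_on_open[OF open_ball] using df by (metis mem_ball_0)
    show "f 0 = 0" "deriv f 0 = 1" by (simp_all add: f_def d1) (simp add: E_def)
    show "deriv f z \<noteq> 0" if "cmod z < 1" for z by (simp add: d1[OF that] E_def)
    show "cmod (deriv (deriv f) z) \<le> cmod (2 * deriv f z + z * deriv (deriv f) z)" if "cmod z < 1" for z
    proof -
      have "cmod (deriv (deriv f) z) \<le> 1 * cmod (2 * deriv f z + z * deriv (deriv f) z)"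
        by (subst ode[OF that], subst norm_mult) (intro mult_right_mono bound[OF that], simp)
      then show ?thesis by simp
    qed
  qed
  then show ?thesis using ode by (rule that)
qed

section \<open>Sharp bounds for the coefficient differences\<close>

text \<open>Two Schur steps yield x = \<open>g 0\<close> and \<open>\<kappa>\<close> =
  \<open>k 0\<close>. The first parameter does not appear separately because it equals the second
  coefficient.\<close>

lemma convK_coefficients:
  assumes "f \<in> convK"
  obtains x \<kappa> where "cmod x \<le> 1" "cmod \<kappa> \<le> 1"
    "3 * taylor_coeff f 3 = 3 * (taylor_coeff f 2)\<^sup>2 + (1 - cnj (taylor_coeff f 2) * taylor_coeff f 2) * x"
    "6 * taylor_coeff f 4 = 6 * (taylor_coeff f 2) ^ 3
        + 5 * taylor_coeff f 2 * (1 - cnj (taylor_coeff f 2) * taylor_coeff f 2) * x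
        - cnj (taylor_coeff f 2) * (1 - cnj (taylor_coeff f 2) * taylor_coeff f 2) * x\<^sup>2
        + (1 - cnj (taylor_coeff f 2) * taylor_coeff f 2) * (1 - cnj x * x) * \<kappa>"
proof -
  have f: "f holomorphic_on ball 0 1" "deriv f 0 = 1"
    using assms by (auto simp: convK_def)
  obtain \<psi> where \<psi>: "\<psi> holomorphic_on ball 0 1" "\<And>z. cmod z < 1 \<Longrightarrow> cmod (\<psi> z) \<le> 1"
    "\<And>z. cmod z < 1 \<Longrightarrow> deriv (deriv f) z = \<psi> z * (2 * deriv f z + z * deriv (deriv f) z)"
    using convK_schur_function[OF assms] by blast
  obtain g where g: "g holomorphic_on ball 0 1" "\<And>z. cmod z < 1 \<Longrightarrow> cmod (g z) \<le> 1"
    "\<And>z. cmod z < 1 \<Longrightarrow> \<psi> z * (1 + cnj (\<psi> 0) * z * g z) = \<psi> 0 + z * g z"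
    using schur_step[OF \<psi>(1,2)] by blast
  obtain k where k: "k holomorphic_on ball 0 1" "\<And>z. cmod z < 1 \<Longrightarrow> cmod (k z) \<le> 1"
    "\<And>z. cmod z < 1 \<Longrightarrow> g z * (1 + cnj (g 0) * z * k z) = g 0 + z * k z"
    using schur_step[OF g(1,2)] by blast
  note c = coefficients_from_schur_parameters[OF f(1) \<psi>(1) g(1) k(1) f(2) \<psi>(3) g(3) k(3)]
  show ?thesis
    by (rule that[of "g 0" "k 0"]) (use g(2)[of 0] k(2)[of 0] c in auto)
qed

text \<open>The third parameter is set to -1 by taking the constant -1 as the second Schur
  transform, and \<open>g\<close> and \<open>\<psi>\<close> are rebuilt from it. For x = -1,
  \<open>g\<close> is itself the constant -1 and the relation collapses to the differential equation
  of L_phi with cos phi = s.\<close>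

lemma convK_extremal:
  fixes s x :: real
  assumes s: "\<bar>s\<bar> \<le> 1" and x: "\<bar>x\<bar> \<le> 1"
  obtains f where "f \<in> convK" "taylor_coeff f 2 = of_real s"
    "3 * taylor_coeff f 3 = of_real (3 * s\<^sup>2 + (1 - s\<^sup>2) * x)"
    "6 * taylor_coeff f 4 = of_real (6 * s ^ 3 + 5 * s * (1 - s\<^sup>2) * x - s * (1 - s\<^sup>2) * x\<^sup>2 - (1 - s\<^sup>2) * (1 - x\<^sup>2))"
    "x = - 1 \<Longrightarrow> (\<forall>z. cmod z < 1 \<longrightarrow>
        deriv (deriv f) z * (1 - 2 * of_real s * z + z\<^sup>2) = 2 * (of_real s - z) * deriv f z)"
proof -
  define g where "g z = (of_real x - z) / (1 - of_real x * z)" for z :: complex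
  define \<psi> where "\<psi> z = (of_real s + z * g z) / (1 + of_real s * (z * g z))" for z :: complex
  have gden: "1 - of_real x * z \<noteq> 0" if "cmod z < 1" for z :: complex
    using moebius_denominator_nonzero[of "of_real x" "- z"] that x by simp
  have g: "cmod (g z) \<le> 1" if "cmod z < 1" for z
    using moebius_bound[of "of_real x" "- z"] that x gden[OF that] by (simp add: g_def norm_divide divide_le_eq)
  have zg: "cmod (z * g z) < 1" if "cmod z < 1" for z
    using g[OF that] that by (metis norm_ge_zero norm_mult mult_left_le order_le_less_trans)
  have den: "1 + of_real s * (z * g z) \<noteq> 0" if "cmod z < 1" for z :: complex
    using moebius_denominator_nonzero[OF _ zg[OF that], of "of_real s"] s by simp
  have holo: "g holomorphic_on ball 0 1" "\<psi> holomorphic_on ball 0 1"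
  proof -
    show g: "g holomorphic_on ball 0 1"
      unfolding g_def by (intro holomorphic_intros) (use gden in auto)
    show "\<psi> holomorphic_on ball 0 1"
      unfolding \<psi>_def by (intro holomorphic_intros g) (use den in auto)
  qed
  have \<psi>: "cmod (\<psi> z) \<le> 1" if "cmod z < 1" for z
    using moebius_bound[of "of_real s" "z * g z"] zg[OF that] s den[OF that]
    by (simp add: \<psi>_def norm_divide divide_le_eq)
  obtain f where f: "f \<in> convK"
    "\<And>z. cmod z < 1 \<Longrightarrow> deriv (deriv f) z = \<psi> z * (2 * deriv f z + z * deriv (deriv f) z)"
    using convK_of_schur_function[OF holo(2) \<psi>] by blast
  have f': "f holomorphic_on ball 0 1" "deriv f 0 = 1"
    using f(1) by (auto simp: convK_def)
  have \<psi>_eq: "\<psi> z * (1 + cnj (of_real s) * z * g z) = of_real s + z * g z" if "cmod z < 1" for z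
    using den[OF that] by (simp add: \<psi>_def mult.assoc)
  have g_eq: "g z * (1 + cnj (of_real x) * z * (- 1)) = of_real x + z * (- 1)" if "cmod z < 1" for z
    using gden[OF that] by (simp add: g_def)
  note c = coefficients_from_schur_parameters[OF f'(1) holo(2,1) holomorphic_on_const f'(2) f(2) \<psi>_eq g_eq]
  show ?thesis
  proof (rule that[OF f(1)])
    show "taylor_coeff f 2 = of_real s"
      by (rule c(1))
    show "3 * taylor_coeff f 3 = of_real (3 * s\<^sup>2 + (1 - s\<^sup>2) * x)"
      using c(2) by (simp add: power2_eq_square)
    show "6 * taylor_coeff f 4 = of_real (6 * s ^ 3 + 5 * s * (1 - s\<^sup>2) * x - s * (1 - s\<^sup>2) * x\<^sup>2 - (1 - s\<^sup>2) * (1 - x\<^sup>2))"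
      using c(3) by (simp add: power2_eq_square algebra_simps)
    show "\<forall>z. cmod z < 1 \<longrightarrow>
        deriv (deriv f) z * (1 - 2 * of_real s * z + z\<^sup>2) = 2 * (of_real s - z) * deriv f z" if "x = - 1"
    proof (intro allI impI)
      fix z :: complex assume z: "cmod z < 1"
      have "g z = - 1" using gden[OF z] by (simp add: g_def that divide_eq_eq)
      then have "\<psi> z * (1 - of_real s * z) = of_real s - z"
        using \<psi>_eq[OF z] by simp
      moreover have "deriv (deriv f) z * (1 - of_real s * z) = (\<psi> z * (1 - of_real s * z)) * (2 * deriv f z + z * deriv (deriv f) z)"
        by (subst f(2)[OF z]) (simp add: mult_ac)
      ultimately have "deriv (deriv f) z * (1 - of_real s * z) = (of_real s - z) * (2 * deriv f z + z * deriv (deriv f) z)"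
        by simp
      then show "deriv (deriv f) z * (1 - 2 * of_real s * z + z\<^sup>2) = 2 * (of_real s - z) * deriv f z"
        by (simp add: algebra_simps power2_eq_square)
    qed
  qed
qed

section \<open>The functions L_phi as members of the class\<close>

lemma taylor_coeff_cong:
  assumes "\<And>z. cmod z < 1 \<Longrightarrow> f z = h z"
  shows "taylor_coeff f n = taylor_coeff h n"
proof -
  have "\<forall>\<^sub>F z in nhds 0. f z = h z"
    using assms by (intro eventually_nhds_in_open[of "ball 0 1" 0, THEN eventually_mono]) auto
  then show ?thesis
    unfolding taylor_coeff_def by (simp add: higher_deriv_cong_ev)
qed

text \<open>The series defining \<open>L_fun\<close> is compared with an extremal function inside
  the disk only; membership has to transfer from that.\<close>

lemma convK_cong:
  assumes "\<And>z. cmod z < 1 \<Longrightarrow> f z = h z" "h \<in> convK"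
  shows "f \<in> convK"
proof -
  have "deriv f 0 = deriv h 0"
    using taylor_coeff_cong[OF assms(1), where n = 1] by (simp add: taylor_coeff_def)
  moreover have "f holomorphic_on ball 0 1 \<longleftrightarrow> h holomorphic_on ball 0 1"
    "inj_on f (ball 0 1) \<longleftrightarrow> inj_on h (ball 0 1)" "f ` ball 0 1 = h ` ball 0 1"
    using assms(1) by (auto intro!: holomorphic_cong inj_on_cong image_cong)
  ultimately show ?thesis
    using assms by (simp add: convK_def)
qed

text \<open>The equation says that f' (1 - 2 cos phi z + z^2) is constant, hence 1. So f' is the
  generating function of the Chebyshev polynomials of the second kind at cos phi, with coefficients
  sin ((n + 1) phi) / sin phi.\<close>

lemma L_coeff_eq_taylor_coeff:
  assumes f: "f \<in> convK" and \<phi>: "sin \<phi> \<noteq> 0"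
    and ode: "\<And>z. cmod z < 1 \<Longrightarrow>
      deriv (deriv f) z * (1 - 2 * of_real (cos \<phi>) * z + z\<^sup>2) = 2 * (of_real (cos \<phi>) - z) * deriv f z"
  shows "taylor_coeff f (Suc n) = of_real (L_coeff \<phi> (Suc n))"
proof -
  define c :: complex where "c = of_real (cos \<phi>)"
  have f': "f holomorphic_on ball 0 1" "deriv f 0 = 1"
    using f by (auto simp: convK_def)
  let ?d = "\<lambda>z. deriv f z * (1 - 2 * c * z + z\<^sup>2)"
  have "(?d has_field_derivative 0) (at z)" if "z \<in> ball 0 1" for z
  proof -
    have d2: "(deriv f has_field_derivative deriv (deriv f) z) (at z)"
      using that by (intro holomorphic_derivI[OF holomorphic_deriv[OF f'(1)]]) auto
    have "(?d has_field_derivative deriv f z * (- 2 * c + 2 * z) + deriv (deriv f) z * (1 - 2 * c * z + z\<^sup>2)) (at z)"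
      by (rule derivative_eq_intros d2 refl | simp)+
    also have "deriv f z * (- 2 * c + 2 * z) + deriv (deriv f) z * (1 - 2 * c * z + z\<^sup>2) = 0"
      using ode[of z] that by (simp add: c_def algebra_simps)
    finally show ?thesis .
  qed
  then have "?d constant_on ball 0 1"
    by (intro has_field_derivative_0_imp_constant_on) auto
  then obtain k where k: "\<And>z. cmod z < 1 \<Longrightarrow> ?d z = k"
    unfolding constant_on_def by auto
  then have "k = 1"
    using k[of 0] f'(2) by simp
  with k have d: "?d z = 1" if "cmod z < 1" for z
    using that by simp
  define F where "F = fps_deriv (fps_expansion f 0)"
  have "F * (1 - fps_const (2 * c) * fps_X + fps_X\<^sup>2) = 1"
    unfolding F_def
    by (rule fps_eq_of_eq_on_ball[of ?d _ "\<lambda>_. 1"])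
       (use d in \<open>auto intro!: fps_expansion_intros holomorphic_has_fps_expansion f'(1)\<close>)
  \<comment> \<open>In this form the substitution of F reads off the three-term recursion.\<close>
  then have e: "F = 1 + fps_X * (fps_const (2 * c) * F - fps_X * F)"
    by (simp add: algebra_simps power2_eq_square)
  have u: "fps_nth F 0 = 1" "fps_nth F (Suc 0) = 2 * c"
    "fps_nth F (Suc (Suc n)) = 2 * c * fps_nth F (Suc n) - fps_nth F n" for n
  proof -
    show "fps_nth F 0 = 1" by (subst e) simp
    then show "fps_nth F (Suc 0) = 2 * c" by (subst e) simp
    show "fps_nth F (Suc (Suc n)) = 2 * c * fps_nth F (Suc n) - fps_nth F n"
      by (subst e) simp
  qed
  have "fps_nth F n = of_real (sin (real (Suc n) * \<phi>) / sin \<phi>)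
    \<and> fps_nth F (Suc n) = of_real (sin (real (Suc (Suc n)) * \<phi>) / sin \<phi>)"
  proof (induction n)
    case 0
    then show ?case using \<phi> u by (simp add: sin_double c_def)
  next
    case (Suc n)
    have "sin (real (Suc (Suc (Suc n))) * \<phi>) = 2 * cos \<phi> * sin (real (Suc (Suc n)) * \<phi>) - sin (real (Suc n) * \<phi>)"
    proof -
      have "sin (real (Suc (Suc n)) * \<phi> + \<phi>) + sin (real (Suc (Suc n)) * \<phi> - \<phi>) = 2 * cos \<phi> * sin (real (Suc (Suc n)) * \<phi>)"
        by (simp add: sin_add sin_diff)
      then show ?thesis by (simp add: algebra_simps)
    qed
    then show ?case using Suc u(3)[of n] \<phi>
      by (simp add: c_def diff_divide_distrib del: of_nat_Suc)
  qed
  then have "of_nat (Suc n) * taylor_coeff f (Suc n) = of_real (sin (real (Suc n) * \<phi>) / sin \<phi>)"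
    by (simp add: F_def taylor_coeff_eq_fps_nth)
  then have "taylor_coeff f (Suc n) = of_real (sin (real (Suc n) * \<phi>) / sin \<phi>) / of_nat (Suc n)"
    by (metis nonzero_mult_div_cancel_left of_nat_neq_0)
  also have "\<dots> = of_real (L_coeff \<phi> (Suc n))"
    using \<phi> by (simp add: L_coeff_def mult_ac del: of_nat_Suc)
  finally show ?thesis .
qed

text \<open>L_phi is the extremal function for x = -1 and s = cos phi, identified through its power
  series. The strict bound on s keeps sin phi away from 0.\<close>

lemma L_fun_convK:
  fixes s :: real
  assumes s: "\<bar>s\<bar> < 1"
  shows "L_fun (arccos s) \<in> convK"
    and "taylor_coeff (L_fun (arccos s)) 2 = of_real s"
    and "3 * taylor_coeff (L_fun (arccos s)) 3 = of_real (4 * s\<^sup>2 - 1)"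
    and "6 * taylor_coeff (L_fun (arccos s)) 4 = of_real (12 * s ^ 3 - 6 * s)"
proof -
  define \<phi> where "\<phi> = arccos s"
  have cos: "cos \<phi> = s" and sin: "sin \<phi> \<noteq> 0"
    using s by (auto simp: \<phi>_def sin_arccos_abs abs_square_eq_1 power2_eq_1_iff)
  obtain f where f: "f \<in> convK" "taylor_coeff f 2 = of_real s"
    "3 * taylor_coeff f 3 = of_real (3 * s\<^sup>2 + (1 - s\<^sup>2) * (-1))"
    "6 * taylor_coeff f 4 = of_real (6 * s ^ 3 + 5 * s * (1 - s\<^sup>2) * (-1) - s * (1 - s\<^sup>2) * (-1)\<^sup>2 - (1 - s\<^sup>2) * (1 - (-1)\<^sup>2))"
    "\<And>z. cmod z < 1 \<Longrightarrow>
        deriv (deriv f) z * (1 - 2 * of_real s * z + z\<^sup>2) = 2 * (of_real s - z) * deriv f z"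
    by (rule convK_extremal[of s "-1"]) (use s in auto)
  have L: "L_fun \<phi> z = f z" if z: "cmod z < 1" for z
  proof -
    have holo: "f holomorphic_on ball 0 1" and f0: "f 0 = 0"
      using f(1) by (auto simp: convK_def)
    have "(\<lambda>n. taylor_coeff f n * z ^ n) sums f z"
      using holomorphic_power_series[OF holo, of z] z by (simp add: taylor_coeff_def)
    then have "(\<lambda>n. taylor_coeff f (Suc n) * z ^ Suc n) sums f z"
      using f0 by (subst sums_Suc_iff) (simp add: taylor_coeff_def)
    then have "(\<lambda>n. of_real (L_coeff \<phi> (Suc n)) * z ^ Suc n) sums f z"
      using L_coeff_eq_taylor_coeff[OF f(1) sin] f(5) cos by simp
    then show ?thesis
      unfolding L_fun_def by (rule sums_unique[symmetric])
  qed
  show "L_fun (arccos s) \<in> convK"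
    using convK_cong[OF L f(1)] by (simp add: \<phi>_def)
  have tc: "taylor_coeff (L_fun (arccos s)) n = taylor_coeff f n" for n
    using taylor_coeff_cong[OF L] by (simp add: \<phi>_def)
  show "taylor_coeff (L_fun (arccos s)) 2 = of_real s"
    "3 * taylor_coeff (L_fun (arccos s)) 3 = of_real (4 * s\<^sup>2 - 1)"
    "6 * taylor_coeff (L_fun (arccos s)) 4 = of_real (12 * s ^ 3 - 6 * s)"
    unfolding tc using f(2-4) by (simp_all add: algebra_simps power2_eq_square power3_eq_cube)
qed

section \<open>Sharp bounds for fixed p\<close>

lemma convKp_iff: "f \<in> convKp p \<longleftrightarrow> f \<in> convK \<and> taylor_coeff f 2 = of_real (p / 2)"
  by (auto simp: convKp_def taylor_coeff_def fact_numeral field_simps)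

lemma cmod_numeral_mult: "cmod (numeral k * w) = numeral k * cmod w"
  by (simp add: norm_mult)

lemma cmod_affine_le: "cmod (of_real a + of_real b * w) \<le> \<bar>a\<bar> + \<bar>b\<bar> * cmod w"
  by (rule order_trans[OF norm_triangle_ineq]) (simp add: norm_mult)

text \<open>At 8/7 the vertex of the quadratic in |x| passes the edge |x| = 1. Both branches take
  the value 103/343 there.\<close>

definition bound34 :: "real \<Rightarrow> real" where
  "bound34 p = (if p < 8/7 then (p^3 + 50*p^2 - 64*p + 64)/192 else (-3*p^3 + 4*p^2 + 6*p - 4)/12)"

lemma bound23_le:
  assumes p: "0 \<le> p" "p \<le> 2" and f: "f \<in> convKp p"
  shows "cmod (taylor_coeff f 3 - taylor_coeff f 2) \<le> (2*p+1)*(2-p)/6"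
proof -
  define s where "s = p / 2"
  have s: "0 \<le> s" "s \<le> 1" "p = 2 * s" using p by (auto simp: s_def)
  have c2: "taylor_coeff f 2 = of_real s" using f by (simp add: convKp_iff s_def)
  obtain x where x: "cmod x \<le> 1" "3 * taylor_coeff f 3 = 3 * (of_real s)\<^sup>2 + (1 - of_real s * of_real s) * x"
    using convK_coefficients[of f] f by (auto simp: convKp_iff c2)
  have t: "0 \<le> 1 - s\<^sup>2" using s by (simp add: power_le_one)
  have "3 * (taylor_coeff f 3 - taylor_coeff f 2) = of_real (- 3 * s * (1 - s)) + of_real (1 - s\<^sup>2) * x"
    using x(2) c2 by (simp add: algebra_simps power2_eq_square)
  then have "cmod (3 * (taylor_coeff f 3 - taylor_coeff f 2)) \<le> \<bar>- 3 * s * (1 - s)\<bar> + \<bar>1 - s\<^sup>2\<bar> * cmod x"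
    by (simp only: cmod_affine_le)
  also have "\<dots> \<le> 3 * s * (1 - s) + (1 - s\<^sup>2) * 1"
    using s x t by (intro add_mono) (auto simp: abs_mult intro!: mult_left_le)
  finally show ?thesis
    unfolding cmod_numeral_mult by (simp add: s(3) algebra_simps power2_eq_square)
qed

text \<open>The left side is what the triangle inequality leaves of 6 |a4 - a3| with s = p/2 and r =
  |x|. Up to constants it is the quadratic |5 s - 2| r - (1 - s) r^2, to be maximised on
  [0, 1].\<close>

lemma bound34_real:
  fixes s r :: real
  assumes s: "0 \<le> s" "s \<le> 1" and r: "0 \<le> r" "r \<le> 1"
  shows "6 * s\<^sup>2 * (1 - s) + (1 - s\<^sup>2) * (\<bar>5 * s - 2\<bar> * r + s * r\<^sup>2 + (1 - r\<^sup>2)) \<le> 6 * bound34 (2 * s)"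
proof (cases "s < 4 / 7")
  case True
  define a where "a = \<bar>5 * s - 2\<bar>"
  have a: "a\<^sup>2 = (5 * s - 2)\<^sup>2" by (simp add: a_def)
  \<comment> \<open>Completed square: the gap to the bound vanishes at the vertex r = a / (2 (1 -
    s)).\<close>
  have "0 \<le> (1 + s) * (2 * (1 - s) * r - a)\<^sup>2 / 4"
    using s by simp
  also have "\<dots> = (1 + s) * (4 * (1 - s)\<^sup>2 * r\<^sup>2 - 4 * (1 - s) * r * a + (5 * s - 2)\<^sup>2) / 4"
    unfolding a[symmetric] by (simp add: power2_eq_square algebra_simps)
  also have "\<dots> = 6 * bound34 (2 * s) - (6 * s\<^sup>2 * (1 - s) + (1 - s\<^sup>2) * (a * r + s * r\<^sup>2 + (1 - r\<^sup>2)))"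
    using True by (simp add: bound34_def field_simps power2_eq_square power3_eq_cube)
  finally show ?thesis by (simp add: a_def)
next
  case False
  then have "\<bar>5 * s - 2\<bar> = 5 * s - 2" by simp
  \<comment> \<open>Now 5 s - 2 >= 2 (1 - s), so the quadratic increases on [0, 1]; the gap is its
    value at 1 minus its value at r.\<close>
  have "0 \<le> (1 - s\<^sup>2) * ((1 - r) * (5 * s - 2 - (1 - s) * (1 + r)))"
  proof -
    have "(1 - s) * (1 + r) \<le> (1 - s) * 2" using s r by (intro mult_left_mono) auto
    with False have "0 \<le> 5 * s - 2 - (1 - s) * (1 + r)" by simp
    then show ?thesis using s r by (intro mult_nonneg_nonneg) (auto simp: power_le_one)
  qed
  also have "\<dots> = 6 * bound34 (2 * s) - (6 * s\<^sup>2 * (1 - s) + (1 - s\<^sup>2) * ((5 * s - 2) * r + s * r\<^sup>2 + (1 - r\<^sup>2)))"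
    using False by (simp add: bound34_def field_simps power2_eq_square power3_eq_cube)
  finally show ?thesis using \<open>\<bar>5 * s - 2\<bar> = 5 * s - 2\<close> by simp
qed

lemma bound34_le:
  assumes p: "0 \<le> p" "p \<le> 2" and f: "f \<in> convKp p"
  shows "cmod (taylor_coeff f 4 - taylor_coeff f 3) \<le> bound34 p"
proof -
  define s where "s = p / 2"
  have s: "0 \<le> s" "s \<le> 1" "p = 2 * s" using p by (auto simp: s_def)
  have c2: "taylor_coeff f 2 = of_real s" using f by (simp add: convKp_iff s_def)
  obtain x \<kappa> where x: "cmod x \<le> 1" "cmod \<kappa> \<le> 1"
    and c3: "3 * taylor_coeff f 3 = 3 * (of_real s)\<^sup>2 + (1 - of_real s * of_real s) * x"
    and c4: "6 * taylor_coeff f 4 = 6 * of_real s ^ 3 + 5 * of_real s * (1 - of_real s * of_real s) * x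
        - of_real s * (1 - of_real s * of_real s) * x\<^sup>2
        + (1 - of_real s * of_real s) * (1 - cnj x * x) * \<kappa>"
    using convK_coefficients[of f] f unfolding convKp_iff c2 complex_cnj_complex_of_real by blast
  define r where "r = cmod x"
  have r: "0 \<le> r" "r \<le> 1" using x by (auto simp: r_def)
  have t: "0 \<le> 1 - s\<^sup>2" "0 \<le> 1 - r\<^sup>2" using s r by (auto simp: power_le_one)
  have xx: "1 - cnj x * x = of_real (1 - r\<^sup>2)"
    using complex_norm_square[of x] by (simp add: r_def mult.commute)
  let ?w = "of_real (5 * s - 2) * x - of_real s * x\<^sup>2 + of_real (1 - r\<^sup>2) * \<kappa>"
  have "6 * (taylor_coeff f 4 - taylor_coeff f 3) = 6 * taylor_coeff f 4 - 2 * (3 * taylor_coeff f 3)"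
    by simp
  also have "\<dots> = of_real (- 6 * s\<^sup>2 * (1 - s)) + of_real (1 - s\<^sup>2) * ?w"
    unfolding c3 c4 xx by (simp add: algebra_simps power2_eq_square power3_eq_cube)
  finally have eq: "6 * (taylor_coeff f 4 - taylor_coeff f 3) = of_real (- 6 * s\<^sup>2 * (1 - s)) + of_real (1 - s\<^sup>2) * ?w" .
  have "cmod ?w \<le> \<bar>5 * s - 2\<bar> * r + s * r\<^sup>2 + (1 - r\<^sup>2)"
  proof -
    have "cmod ?w \<le> cmod (of_real (5 * s - 2) * x) + cmod (of_real s * x\<^sup>2) + cmod (of_real (1 - r\<^sup>2) * \<kappa>)"
      by (intro norm_triangle_mono norm_triangle_ineq4 order_refl)
    also have "\<dots> \<le> \<bar>5 * s - 2\<bar> * r + s * r\<^sup>2 + (1 - r\<^sup>2)"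
      unfolding norm_mult norm_of_real norm_power r_def[symmetric]
      using s t x by (intro add_mono) (auto intro!: mult_left_le)
    finally show ?thesis .
  qed
  then have "(1 - s\<^sup>2) * cmod ?w \<le> (1 - s\<^sup>2) * (\<bar>5 * s - 2\<bar> * r + s * r\<^sup>2 + (1 - r\<^sup>2))"
    using t by (intro mult_left_mono)
  moreover have "cmod (6 * (taylor_coeff f 4 - taylor_coeff f 3)) \<le> 6 * s\<^sup>2 * (1 - s) + (1 - s\<^sup>2) * cmod ?w"
  proof -
    have "cmod (6 * (taylor_coeff f 4 - taylor_coeff f 3)) \<le> \<bar>- 6 * s\<^sup>2 * (1 - s)\<bar> + \<bar>1 - s\<^sup>2\<bar> * cmod ?w"
      unfolding eq by (rule cmod_affine_le)
    moreover have "\<bar>- 6 * s\<^sup>2 * (1 - s)\<bar> = 6 * s\<^sup>2 * (1 - s)" using s by (simp add: abs_mult)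
    ultimately show ?thesis using t by simp
  qed
  ultimately have "cmod (6 * (taylor_coeff f 4 - taylor_coeff f 3)) \<le> 6 * bound34 (2 * s)"
    using bound34_real[OF s(1,2) r] by linarith
  then show ?thesis unfolding cmod_numeral_mult by (simp add: s(3))
qed

text \<open>With x = -1 both summands of 3 (a3 - a2) are nonpositive, so nothing is lost in the
  triangle inequality.\<close>

lemma bound23_attained:
  assumes p: "0 \<le> p" "p \<le> 2"
  shows "\<exists>f\<in>convKp p. cmod (taylor_coeff f 3 - taylor_coeff f 2) = (2*p+1)*(2-p)/6"
proof -
  obtain f where f: "f \<in> convK" "taylor_coeff f 2 = of_real (p / 2)"
    "3 * taylor_coeff f 3 = of_real (3 * (p / 2)\<^sup>2 + (1 - (p / 2)\<^sup>2) * (-1))"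
    by (rule convK_extremal[of "p / 2" "-1"]) (use p in auto)
  have "3 * (taylor_coeff f 3 - taylor_coeff f 2) = 3 * taylor_coeff f 3 - 3 * taylor_coeff f 2"
    by simp
  also have "\<dots> = of_real (3 * (p / 2)\<^sup>2 + (1 - (p / 2)\<^sup>2) * (-1) - 3 * (p / 2))"
    unfolding f(2,3) by (simp only: of_real_diff of_real_mult of_real_numeral)
  also have "3 * (p / 2)\<^sup>2 + (1 - (p / 2)\<^sup>2) * (-1) - 3 * (p / 2) = - 3 * ((2*p+1)*(2-p)/6)"
    by (simp add: field_simps power2_eq_square)
  finally have "cmod (3 * (taylor_coeff f 3 - taylor_coeff f 2)) = \<bar>- 3 * ((2*p+1)*(2-p)/6)\<bar>"
    by (simp only: norm_of_real)
  also have "\<dots> = 3 * ((2*p+1)*(2-p)/6)" using p by (simp add: abs_mult)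
  finally have "cmod (taylor_coeff f 3 - taylor_coeff f 2) = (2*p+1)*(2-p)/6"
    unfolding cmod_numeral_mult by linarith
  moreover have "f \<in> convKp p" using f(1,2) by (simp only: convKp_iff)
  ultimately show ?thesis by blast
qed

lemma bound34_attained:
  assumes p: "0 \<le> p" "p \<le> 2"
  shows "\<exists>f\<in>convKp p. cmod (taylor_coeff f 4 - taylor_coeff f 3) = bound34 p"
proof -
  define s where "s = p / 2"
  have s: "0 \<le> s" "s \<le> 1" "p = 2 * s" using p by (auto simp: s_def)
  \<comment> \<open>|x| is the maximiser of the quadratic, and the sign makes (5 s - 2) x
    nonpositive, like all other summands of 6 (a4 - a3).\<close>
  define x where "x = (if s < 4 / 7 then - (5 * s - 2) / (2 * (1 - s)) else - 1)"
  have x: "\<bar>x\<bar> \<le> 1" using s by (auto simp: x_def abs_le_iff divide_simps)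
  obtain f where f: "f \<in> convK" "taylor_coeff f 2 = of_real s"
    "3 * taylor_coeff f 3 = of_real (3 * s\<^sup>2 + (1 - s\<^sup>2) * x)"
    "6 * taylor_coeff f 4 = of_real (6 * s ^ 3 + 5 * s * (1 - s\<^sup>2) * x - s * (1 - s\<^sup>2) * x\<^sup>2 - (1 - s\<^sup>2) * (1 - x\<^sup>2))"
    by (rule convK_extremal[of s x]) (use s x in auto)
  have "6 * (taylor_coeff f 4 - taylor_coeff f 3) = 6 * taylor_coeff f 4 - 2 * (3 * taylor_coeff f 3)"
    by simp
  also have "\<dots> = of_real (6 * s ^ 3 + 5 * s * (1 - s\<^sup>2) * x - s * (1 - s\<^sup>2) * x\<^sup>2 - (1 - s\<^sup>2) * (1 - x\<^sup>2)
      - 2 * (3 * s\<^sup>2 + (1 - s\<^sup>2) * x))"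
    unfolding f(3,4) by (simp only: of_real_diff of_real_mult of_real_numeral)
  also have "6 * s ^ 3 + 5 * s * (1 - s\<^sup>2) * x - s * (1 - s\<^sup>2) * x\<^sup>2 - (1 - s\<^sup>2) * (1 - x\<^sup>2)
      - 2 * (3 * s\<^sup>2 + (1 - s\<^sup>2) * x) = - 6 * bound34 p"
  proof (cases "s < 4 / 7")
    case True
    have a: "(1 - s) * x = (2 - 5 * s) / 2" using True by (simp add: x_def field_simps)
    have "6 * s ^ 3 + 5 * s * (1 - s\<^sup>2) * x - s * (1 - s\<^sup>2) * x\<^sup>2 - (1 - s\<^sup>2) * (1 - x\<^sup>2) - 2 * (3 * s\<^sup>2 + (1 - s\<^sup>2) * x)
        = 6 * s ^ 3 - 6 * s\<^sup>2 - (1 - s\<^sup>2) + (1 + s) * ((5 * s - 2) * ((1 - s) * x) + ((1 - s) * x)\<^sup>2)"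
      by (simp add: algebra_simps power2_eq_square power3_eq_cube)
    also have "\<dots> = - 6 * bound34 p"
      unfolding a s(3) using True by (simp add: bound34_def field_simps power2_eq_square power3_eq_cube)
    finally show ?thesis .
  next
    case False
    then show ?thesis by (simp add: x_def s(3) bound34_def field_simps power2_eq_square power3_eq_cube)
  qed
  finally have "cmod (6 * (taylor_coeff f 4 - taylor_coeff f 3)) = \<bar>- 6 * bound34 p\<bar>"
    by (simp only: norm_of_real)
  moreover have "f \<in> convKp p" using f by (simp add: convKp_iff s_def)
  \<comment> \<open>The sign of the bound, needed to drop the absolute value, comes for free since
    it dominates a norm.\<close>
  moreover from this have "0 \<le> bound34 p"
    using bound34_le[OF p] norm_ge_zero order_trans by blast
  ultimately show ?thesis unfolding cmod_numeral_mult by (intro bexI[of _ f]) simp_all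
qed

section \<open>Maximising the bounds over p\<close>

lemma bound23_max: "(2 * p + 1) * (2 - p) / 6 \<le> (25 / 48 :: real)"
proof -
  \<comment> \<open>3/4 is the vertex of the parabola in p, and equals 2 cos phi for cos phi =
    3/8.\<close>
  have "0 \<le> (p - 3 / 4)\<^sup>2 / 3" by simp
  also have "\<dots> = 25 / 48 - (2 * p + 1) * (2 - p) / 6"
    by (simp add: field_simps power2_eq_square)
  finally show ?thesis by simp
qed

text \<open>292 = 243 + 49: the first estimate says exactly that 1/3 <= (35 sqrt 70 -
  49)/729.\<close>

lemma sqrt_70_bounds: "292 \<le> 35 * sqrt 70" "sqrt 70 < 9"
proof -
  have "292 / 35 \<le> sqrt 70" by (rule real_le_rsqrt) (simp add: power2_eq_square)
  then show "292 \<le> 35 * sqrt 70" by simp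
  show "sqrt 70 < 9" by (rule real_less_lsqrt) auto
qed

text \<open>\<open>q\<close> is the positive zero of the derivative of the second branch, which is
  (6 + 8 p - 9 p^2)/12. The quadratic relation reduces the cubic to a linear expression in
  q.\<close>

lemma cubic_at_critical_point:
  defines "q \<equiv> (4 + sqrt 70) / 9"
  shows "(- 3 * q ^ 3 + 4 * q\<^sup>2 + 6 * q - 4) / 12 = (35 * sqrt 70 - 49) / 729"
    and "9 * q\<^sup>2 = 8 * q + 6"
proof -
  have "sqrt 70 * sqrt 70 = 70" by simp
  then show q2: "9 * q\<^sup>2 = 8 * q + 6"
    by (simp add: q_def power2_eq_square field_simps)
  then have "q\<^sup>2 = (8 * q + 6) / 9" by simp
  moreover from this have "q ^ 3 = (8 * ((8 * q + 6) / 9) + 6 * q) / 9"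
    by (simp add: power3_eq_cube power2_eq_square algebra_simps)
  ultimately show "(- 3 * q ^ 3 + 4 * q\<^sup>2 + 6 * q - 4) / 12 = (35 * sqrt 70 - 49) / 729"
    by (simp add: q_def field_simps)
qed

lemma bound34_max:
  assumes p: "0 \<le> p" "p \<le> 2"
  shows "bound34 p \<le> (35 * sqrt 70 - 49) / 729"
proof (cases "p < 8 / 7")
  case True
  \<comment> \<open>The expression is 192 times the first branch minus 64, so this branch never
    exceeds its value 1/3 at p = 0.\<close>
  have "p * (p\<^sup>2 + 50 * p - 64) \<le> 0"
  proof (rule mult_nonneg_nonpos[OF p(1)])
    have "p\<^sup>2 \<le> (8 / 7)\<^sup>2" using p True by (intro power_mono) auto
    with True show "p\<^sup>2 + 50 * p - 64 \<le> 0" by (simp add: power2_eq_square)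
  qed
  then have "bound34 p \<le> 1 / 3"
    using True by (simp add: bound34_def algebra_simps power2_eq_square power3_eq_cube)
  also have "1 / 3 \<le> (35 * sqrt 70 - 49) / 729" using sqrt_70_bounds by simp
  finally show ?thesis .
next
  case False
  define q where "q = (4 + sqrt 70) / 9"
  note q = cubic_at_critical_point[folded q_def]
  have "q > 1" using sqrt_70_bounds by (simp add: q_def)
  \<comment> \<open>Taylor expansion of the cubic at its critical point: the difference has a double
    zero at q, and the linear term displayed below vanishes because 9 q^2 = 8 q + 6.\<close>
  have "0 \<le> (p - q)\<^sup>2 * (3 * p + 6 * q - 4) / 12"
    using p \<open>q > 1\<close> by simp
  also have "\<dots> = (- 3 * q ^ 3 + 4 * q\<^sup>2 + 6 * q - 4) / 12 - (- 3 * p ^ 3 + 4 * p\<^sup>2 + 6 * p - 4) / 12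
      + (9 * q\<^sup>2 - 8 * q - 6) * (q - p) / 12"
    by (simp add: field_simps power2_eq_square power3_eq_cube)
  finally show ?thesis using False q by (simp add: bound34_def)
qed

lemma convKplus_iff: "f \<in> convKplus \<longleftrightarrow> (\<exists>p. 0 \<le> p \<and> p \<le> 2 \<and> f \<in> convKp p)"
  by (auto simp: convKplus_def)

theorem theorem3:
  shows
  "(\<forall>p::real. 0 \<le> p \<and> p \<le> 2 \<longrightarrow>
      (\<forall>f\<in>convKp p. cmod (taylor_coeff f 3 - taylor_coeff f 2) \<le> (2*p+1)*(2-p)/6)
    \<and> (\<exists>f\<in>convKp p. cmod (taylor_coeff f 3 - taylor_coeff f 2) = (2*p+1)*(2-p)/6)
    \<and> (\<forall>f\<in>convKp p. cmod (taylor_coeff f 4 - taylor_coeff f 3) \<le>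
          (if p < 8/7 then (p^3 + 50*p^2 - 64*p + 64)/192 else (-3*p^3 + 4*p^2 + 6*p - 4)/12))
    \<and> (\<exists>f\<in>convKp p. cmod (taylor_coeff f 4 - taylor_coeff f 3) =
          (if p < 8/7 then (p^3 + 50*p^2 - 64*p + 64)/192 else (-3*p^3 + 4*p^2 + 6*p - 4)/12)))
   \<and> (\<forall>f\<in>convKplus. cmod (taylor_coeff f 3 - taylor_coeff f 2) \<le> 25/48)
   \<and> (SUP f\<in>convKplus. cmod (taylor_coeff f 3 - taylor_coeff f 2)) = 25/48
   \<and> L_fun (arccos (3/8)) \<in> convKplus
   \<and> cmod (taylor_coeff (L_fun (arccos (3/8))) 3 - taylor_coeff (L_fun (arccos (3/8))) 2) = 25/48
   \<and> (\<forall>f\<in>convKplus. cmod (taylor_coeff f 4 - taylor_coeff f 3) \<le> (35 * sqrt 70 - 49)/729)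
   \<and> (SUP f\<in>convKplus. cmod (taylor_coeff f 4 - taylor_coeff f 3)) = (35 * sqrt 70 - 49)/729
   \<and> L_fun (arccos ((4 + sqrt 70)/18)) \<in> convKplus
   \<and> cmod (taylor_coeff (L_fun (arccos ((4 + sqrt 70)/18))) 4
            - taylor_coeff (L_fun (arccos ((4 + sqrt 70)/18))) 3) = (35 * sqrt 70 - 49)/729"
proof -
  \<comment> \<open>Half of the critical value of p, hence the cosine of the extremal angle.\<close>
  define s :: real where "s = (4 + sqrt 70) / 18"
  have s: "0 \<le> s" "s < 1" using sqrt_70_bounds by (simp_all add: s_def)
  define A where "A = L_fun (arccos (3/8))"
  define B where "B = L_fun (arccos s)"
  have "A \<in> convKp (3/4)"
    unfolding convKp_iff A_def using L_fun_convK(1,2)[of "3/8"] by simp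
  then have A: "A \<in> convKplus"
    unfolding convKplus_iff by (intro exI[of _ "3/4"]) simp
  have "B \<in> convKp (2 * s)"
    unfolding convKp_iff B_def using L_fun_convK(1,2)[of s] s by simp
  then have B: "B \<in> convKplus"
    unfolding convKplus_iff using s by (intro exI[of _ "2 * s"]) simp
  have le23: "\<forall>f\<in>convKplus. cmod (taylor_coeff f 3 - taylor_coeff f 2) \<le> 25/48"
    by (meson convKplus_iff bound23_le bound23_max order_trans)
  have le34: "\<forall>f\<in>convKplus. cmod (taylor_coeff f 4 - taylor_coeff f 3) \<le> (35 * sqrt 70 - 49)/729"
    by (meson convKplus_iff bound34_le bound34_max order_trans)
  have eqA: "cmod (taylor_coeff A 3 - taylor_coeff A 2) = 25/48"
  proof -
    have "3 * taylor_coeff A 3 = of_real (- 7 / 16)" "taylor_coeff A 2 = of_real (3 / 8)"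
      using L_fun_convK(2,3)[of "3/8"] by (simp_all add: A_def power2_eq_square)
    then have "taylor_coeff A 3 - taylor_coeff A 2 = of_real (- 25 / 48)"
      by (simp add: field_simps)
    then show ?thesis by (simp only: norm_of_real)
  qed
  have eqB: "cmod (taylor_coeff B 4 - taylor_coeff B 3) = (35 * sqrt 70 - 49)/729"
  proof -
    have "6 * (taylor_coeff B 4 - taylor_coeff B 3) = 6 * taylor_coeff B 4 - 2 * (3 * taylor_coeff B 3)"
      by simp
    also have "\<dots> = of_real (12 * s ^ 3 - 6 * s - 2 * (4 * s\<^sup>2 - 1))"
      using L_fun_convK(3,4)[of s] s by (simp add: B_def)
    \<comment> \<open>The left side is -6 times the second branch at p = 2 s, which is the critical
      point.\<close>
    also have "12 * s ^ 3 - 6 * s - 2 * (4 * s\<^sup>2 - 1) = - 6 * ((35 * sqrt 70 - 49)/729)"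
    proof -
      have "(4 + sqrt 70) / 9 = 2 * s" by (simp add: s_def)
      note cubic = cubic_at_critical_point(1)[unfolded this]
      show ?thesis
        unfolding cubic[symmetric] by (simp add: power_mult_distrib)
    qed
    finally have "cmod (6 * (taylor_coeff B 4 - taylor_coeff B 3)) = \<bar>- 6 * ((35 * sqrt 70 - 49)/729)\<bar>"
      by (simp only: norm_of_real)
    also have "\<dots> = 6 * ((35 * sqrt 70 - 49)/729)" using sqrt_70_bounds by simp
    finally show ?thesis unfolding cmod_numeral_mult by simp
  qed
  have sup23: "(SUP f\<in>convKplus. cmod (taylor_coeff f 3 - taylor_coeff f 2)) = 25/48"
    using le23 by (intro cSup_eq_maximum) (auto simp flip: eqA intro: A)
  have sup34: "(SUP f\<in>convKplus. cmod (taylor_coeff f 4 - taylor_coeff f 3)) = (35 * sqrt 70 - 49)/729"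
    using le34 by (intro cSup_eq_maximum) (auto simp flip: eqB intro: B)
  show ?thesis
    unfolding s_def[symmetric] A_def[symmetric] B_def[symmetric] bound34_def[symmetric]
    using bound23_le bound23_attained bound34_le bound34_attained A B le23 le34 eqA eqB sup23 sup34
    by blast
qed

end
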